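(* Consider the stochastic model-based algorithm of the context applied to $\psi=f+\omega$, where the samples are i.i.d., $\omega$ is $\kappa$-weakly convex and $L_\omega$-Lipschitz on $\operatorname{dom}\omega$, the model satisfies conditions (M) of the context with parameter $\tau$ and the reference Lipschitz continuity (R) of the context with Lipschitz constants $\mathsf{Lip}(x,\xi)$ and noise parameter $\sigma$, the envelope $\psi_{1/\rho}$ is bounded below by $-\Lambda\le0$, and its level sets are bounded with bounds $\mathsf{B}_v$ as in the context. Let $\rho>\kappa+\tau$, $\alpha>0$, and run the algorithm for $K$ iterations with $$\gamma_k=\rho+\tau+\kappa+\max\{\mathsf{Lip}(x^k,\xi'),\alpha\}\sqrt{K},$$ where at each iteration $\xi'\sim\Xi$ is a sample independent of $\xi^k$ (and of the past). Let $\Delta=\psi_{1/\rho}(x^1)+\Lambda+\frac{\rho}{\alpha^2}(\alpha+\sigma+L_\omega)^2>0$ and $D=\psi(x^1)-\inf_x\psi(x)$. Given $\delta\in(0,1/4)$ and $p\in(2\delta,1)$, with probability at least $1-p$, $(1-2p^{-1}\delta)K$ of the iterates lie in the ball (centered at the origin) of radius $$\mathsf{R}(\delta)=\mathsf{B}_{\delta^{-1}\Delta}+\frac{4(\alpha+\sigma+L_\omega)}{\alpha\sqrt{K}},$$ and $$\min_{1\le k\le K}\mathbb{E}\big[\|\nabla\psi_{1/\rho}(x^k)\|^2\big]\le\frac{p}{p-2\delta}\cdot\frac{2\rho}{\rho-\tau-\kappa}\left[D+\frac{\rho}{\alpha^2}(\alpha+\sigma+L_\omega)^2\right]\left(\frac{\rho+\tau+\kappa}{K}+\frac{\alpha+\mathsf{G}_\delta}{\sqrt{K}}\right),$$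 where $\mathsf{G}_\delta=\max_{\|x\|\le\mathsf{R}(\delta)}\sup_{\xi\sim\Xi}\mathsf{Lip}(x,\xi)$.
   Context: Problem: minimize over $x\in\mathbb{R}^n$ the function $\psi(x)=f(x)+\omega(x)$, $f(x)=\mathbb{E}_{\xi\sim\Xi}[f(x,\xi)]$, where $f(\cdot,\xi)$ is continuous and weakly convex and $\omega$ is lower semicontinuous and extended-valued. A function $g$ is $\lambda$-weakly convex ($\lambda\ge0$) if $g+\frac{\lambda}{2}\|\cdot\|^2$ is convex. $\|\cdot\|$ is the Euclidean norm. Algorithm: start from a fixed $x^1\in\operatorname{dom}\omega$; for $k=1,2,\dots$ draw $\xi^k\sim\Xi$, choose $\gamma_k>0$ and set $x^{k+1}=\arg\min_x\{f_{x^k}(x,\xi^k)+\omega(x)+\frac{\gamma_k}{2}\|x-x^k\|^2\}$, where $f_x(\cdot,\xi)$ is a stochastic model function of $f$ at $x$. Assumptions. The samples are i.i.d. $\omega$ is $\kappa$-weakly convex and $L_\omega$-Lipschitz on $\operatorname{dom}\omega$. (M) $\mathbb{E}_\xi[f_x(x,\xi)]=f(x)$ for all $x\in\operatorname{dom}\omega$; $\mathbb{E}_\xi[f_x(y,\xi)-f(y)]\le\frac{\tau}{2}\|x-y\|^2$ for all $x,y\in\operatorname{dom}\omega$; and $f_x(y,\xi)$ is convex in $y$ for all $x,y\in\operatorname{dom}\omega$, $\xi\sim\Xi$. (R) For every fixed $x\in\operatorname{dom}\omega$ and $\xi\sim\Xi$, $f_x(z,\xi)-f_x(y,\xi)\le\mathsf{Lip}(x,\xi)\|z-y\|$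 for all $y,z$; and for independent $\xi,\xi'\sim\Xi$, $\mathbb{E}_{\xi,\xi'}[|\mathsf{Lip}(x,\xi)-\mathsf{Lip}(x,\xi')|^2]\le\sigma^2<\infty$. Moreau envelope: $\psi_{1/\rho}(x)=\min_z\{\psi(z)+\frac{\rho}{2}\|z-x\|^2\}$; with $\hat{x}=\arg\min_z\{\psi(z)+\frac{\rho}{2}\|z-x\|^2\}$ one has $\nabla\psi_{1/\rho}(x)=\rho(x-\hat{x})$. It is assumed that $\psi_{1/\rho}(x)\ge-\Lambda$ for all $x$, with $-\Lambda\le0$. Level sets: for every $v$, the level set $\mathcal{L}_v=\{x:\psi_{1/\rho}(x)\le v\}$ has bounded diameter, $\operatorname{diam}(\mathcal{L}_v)\le\mathsf{B}_v<\infty$, where the bound $\mathsf{B}_v$ is understood to be such that $\|x\|\ge\mathsf{B}_v$ implies $\psi_{1/\rho}(x)\ge v$.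
   Formalization: The expectation in the gradient bound is the conditional mean given that at least (1-2δ/p)K iterates lie in the ball and x^k is one of them (an event of probability at least 1-p for each k); the bound for the unconditional expectation is false in general. *)

theory Defs
  imports "HOL-Probability.Probability"
begin

section \<open>Extended-valued functions\<close>

definition edom :: "('a \<Rightarrow> ereal) \<Rightarrow> 'a set" where
  "edom g = {x. g x < \<infinity>}"

definition lower_semicontinuous :: "('a::topological_space \<Rightarrow> ereal) \<Rightarrow> bool" where
  "lower_semicontinuous g \<longleftrightarrow> (\<forall>x. g x \<le> Liminf (at x) g)"

text \<open>Convexity for functions that do not take the value \<open>-\<infinity>\<close>.\<close>

definition econvex :: "('a::real_vector \<Rightarrow> ereal) \<Rightarrow> bool" where
  "econvex g \<longleftrightarrow> (\<forall>x y. \<forall>t. 0 < t \<and> t < 1 \<longrightarrow>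
     g ((1 - t) *\<^sub>R x + t *\<^sub>R y) \<le> ereal (1 - t) * g x + ereal t * g y)"

definition weakly_convex :: "real \<Rightarrow> ('a::real_normed_vector \<Rightarrow> ereal) \<Rightarrow> bool" where
  "weakly_convex l g \<longleftrightarrow> 0 \<le> l \<and> econvex (\<lambda>x. g x + ereal (l / 2 * (norm x)\<^sup>2))"

text \<open>\<open>moreau_env \<rho> \<psi>\<close> is the envelope \<open>\<psi>\<^bsub>1/\<rho>\<^esub>\<close>.\<close>

definition moreau_env :: "real \<Rightarrow> ('a::real_normed_vector \<Rightarrow> ereal) \<Rightarrow> 'a \<Rightarrow> ereal" where
  "moreau_env \<rho> \<psi> x = (INF z. \<psi> z + ereal (\<rho> / 2 * (norm (z - x))\<^sup>2))"

definition gradient :: "('a::real_inner \<Rightarrow> real) \<Rightarrow> 'a \<Rightarrow> 'a" where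
  "gradient g x = (THE D. GDERIV g x :> D)"


section \<open>Stochastic models\<close>

text \<open>
  A model \<open>fm\<close> is written \<open>fm x y s\<close> for \<open>f\<^sub>x(y, s)\<close>: \<open>x\<close> is the reference point, \<open>y\<close> the
  argument and \<open>s\<close> the sample.  A condition ``for \<open>s \<sim> \<Xi>\<close>'' is imposed on every \<open>s \<in> space \<Xi>\<close>,
  and the suprema over \<open>s \<sim> \<Xi>\<close> are taken over \<open>space \<Xi>\<close> accordingly.
\<close>

definition model_condition ::
  "'s measure \<Rightarrow> 'a::euclidean_space set \<Rightarrow> ('a \<Rightarrow> real) \<Rightarrow> real \<Rightarrow> ('a \<Rightarrow> 'a \<Rightarrow> 's \<Rightarrow> real) \<Rightarrow> bool"
where
  "model_condition \<Xi> C f \<tau> fm \<longleftrightarrow>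
     (\<forall>x\<in>C. \<forall>y\<in>C. integrable \<Xi> (fm x y)) \<and>
     (\<forall>x\<in>C. (\<integral>s. fm x x s \<partial>\<Xi>) = f x) \<and>
     (\<forall>x\<in>C. \<forall>y\<in>C. (\<integral>s. fm x y s - f y \<partial>\<Xi>) \<le> \<tau> / 2 * (norm (x - y))\<^sup>2) \<and>
     (\<forall>x\<in>C. \<forall>s\<in>space \<Xi>. convex_on C (\<lambda>y. fm x y s))"

definition reference_lipschitz ::
  "'s measure \<Rightarrow> 'a::euclidean_space set \<Rightarrow> ('a \<Rightarrow> 'a \<Rightarrow> 's \<Rightarrow> real) \<Rightarrow> ('a \<Rightarrow> 's \<Rightarrow> real) \<Rightarrow> real \<Rightarrow> bool"
where
  "reference_lipschitz \<Xi> C fm Lip \<sigma> \<longleftrightarrow>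
     (\<forall>x\<in>C. \<forall>s\<in>space \<Xi>. \<forall>y z. fm x z s - fm x y s \<le> Lip x s * norm (z - y)) \<and>
     (\<forall>x\<in>C. (\<integral>\<^sup>+ (s, s'). ennreal (\<bar>Lip x s - Lip x s'\<bar>\<^sup>2) \<partial>(\<Xi> \<Otimes>\<^sub>M \<Xi>)) \<le> ennreal (\<sigma>\<^sup>2))"

text \<open>
  Joint measurability, so that the iterates are random variables and expectations of
  \<open>fm\<close> and \<open>Lip\<close> at random arguments make sense.
\<close>

definition measurable_model ::
  "'s measure \<Rightarrow> 'a::euclidean_space set \<Rightarrow> ('a \<Rightarrow> 'a \<Rightarrow> 's \<Rightarrow> real) \<Rightarrow> ('a \<Rightarrow> 's \<Rightarrow> real) \<Rightarrow> bool"
where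
  "measurable_model \<Xi> C fm Lip \<longleftrightarrow>
     (\<lambda>(x, y, s). fm x y s)
       \<in> borel_measurable (restrict_space borel C \<Otimes>\<^sub>M restrict_space borel C \<Otimes>\<^sub>M \<Xi>) \<and>
     (\<lambda>(x, s). Lip x s) \<in> borel_measurable (restrict_space borel C \<Otimes>\<^sub>M \<Xi>)"

text \<open>
  \<open>B v\<close> bounds the diameter of the level set of \<open>e\<close> at \<open>v\<close>, and outside the ball of radius \<open>B v\<close>
  around the origin \<open>e\<close> is at least \<open>v\<close>.  Boundedness is stated separately because \<^const>\<open>diameter\<close>
  is meaningful for bounded sets only.
\<close>

definition level_set_bound :: "('a::euclidean_space \<Rightarrow> ereal) \<Rightarrow> (real \<Rightarrow> real) \<Rightarrow> bool" where
  "level_set_bound e B \<longleftrightarrow> (\<forall>v.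
     bounded {x. e x \<le> ereal v} \<and> diameter {x. e x \<le> ereal v} \<le> B v \<and>
     (\<forall>x. B v \<le> norm x \<longrightarrow> ereal v \<le> e x))"

text \<open>Takes values in \<^typ>\<open>ennreal\<close> since the supremum may be infinite; \<open>Lip\<close> is only given on \<open>C\<close>.\<close>

definition lip_sup :: "'s measure \<Rightarrow> 'a::euclidean_space set \<Rightarrow> ('a \<Rightarrow> 's \<Rightarrow> real) \<Rightarrow> real \<Rightarrow> ennreal" where
  "lip_sup \<Xi> C Lip r = (SUP x \<in> C \<inter> cball 0 r. SUP s \<in> space \<Xi>. ennreal (Lip x s))"


section \<open>The algorithm\<close>

text \<open>
  \<open>\<xi> k\<close> and \<open>\<xi>' k\<close> (for \<open>k = 1, ..., K\<close>) are \<open>2K\<close> independent samples with law \<open>\<Xi>\<close>; \<open>\<xi>' k\<close> is the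
  extra sample used for choosing the \<open>k\<close>-th regularization parameter.
\<close>

definition iid_samples :: "'w measure \<Rightarrow> 's measure \<Rightarrow> nat \<Rightarrow> (nat \<Rightarrow> 'w \<Rightarrow> 's) \<Rightarrow> (nat \<Rightarrow> 'w \<Rightarrow> 's) \<Rightarrow> bool"
where
  "iid_samples M \<Xi> K \<xi> \<xi>' \<longleftrightarrow>
     prob_space M \<and> prob_space \<Xi> \<and>
     prob_space.indep_vars M (\<lambda>_. \<Xi>) (case_sum \<xi> \<xi>') ({1..K} <+> {1..K}) \<and>
     (\<forall>k\<in>{1..K}. distr M \<Xi> (\<xi> k) = \<Xi> \<and> distr M \<Xi> (\<xi>' k) = \<Xi>)"

definition model_based_run ::
  "'w measure \<Rightarrow> ('a::euclidean_space \<Rightarrow> 'a \<Rightarrow> 's \<Rightarrow> real) \<Rightarrow> ('a \<Rightarrow> ereal) \<Rightarrow> 'a \<Rightarrow> nat \<Rightarrow> (nat \<Rightarrow> 'w \<Rightarrow> 's)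
     \<Rightarrow> (nat \<Rightarrow> 'w \<Rightarrow> real) \<Rightarrow> (nat \<Rightarrow> 'w \<Rightarrow> 'a) \<Rightarrow> bool"
where
  "model_based_run M fm \<omega> x1 K \<xi> \<gamma> x \<longleftrightarrow>
     (\<forall>w\<in>space M. x 1 w = x1 \<and>
        (\<forall>k\<in>{1..K}. is_arg_min
           (\<lambda>y. ereal (fm (x k w) y (\<xi> k w)) + \<omega> y + ereal (\<gamma> k w / 2 * (norm (y - x k w))\<^sup>2))
           (\<lambda>_. True) (x (Suc k) w)))"


section \<open>Events and conditional expectations\<close>

text \<open>At least \<open>m\<close> of the first \<open>K\<close> iterates lie in the ball of radius \<open>r\<close> around the origin.\<close>

definition many_in_ball ::
  "'w measure \<Rightarrow> (nat \<Rightarrow> 'w \<Rightarrow> 'a::euclidean_space) \<Rightarrow> nat \<Rightarrow> real \<Rightarrow> real \<Rightarrow> 'w set"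
where
  "many_in_ball M x K r m = {w \<in> space M. m \<le> real (card {k \<in> {1..K}. x k w \<in> cball 0 r})}"

text \<open>
  At least \<open>m\<close> of the first \<open>K\<close> iterates lie in the ball, and the \<open>k\<close>-th iterate is one of them.
  These are the events on which a gradient bound is claimed: an assertion made ``with high
  probability'' about a mean of \<open>\<parallel>\<nabla>\<psi>\<^bsub>1/\<rho>\<^esub>(x\<^sup>k)\<parallel>\<^sup>2\<close> and involving Lipschitz constants in
  the ball only is read as one about the conditional mean given that event.  The unconditional mean
  is not controlled by these constants, since iterates that leave the ball contribute to it.
\<close>

definition kth_in_ball ::
  "'w measure \<Rightarrow> (nat \<Rightarrow> 'w \<Rightarrow> 'a::euclidean_space) \<Rightarrow> nat \<Rightarrow> real \<Rightarrow> real \<Rightarrow> nat \<Rightarrow> 'w set"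
where
  "kth_in_ball M x K r m k = many_in_ball M x K r m \<inter> {w. x k w \<in> cball 0 r}"

text \<open>Conditional expectation of a nonnegative variable given an event of positive probability.\<close>

definition expectation_given :: "'w measure \<Rightarrow> 'w set \<Rightarrow> ('w \<Rightarrow> real) \<Rightarrow> ennreal" where
  "expectation_given M A X = (\<integral>\<^sup>+ w. ennreal (X w) \<partial>(uniform_measure M A))"

end

theory Submission
  imports Defs
begin

text \<open>
  Strong convexity of the subproblem, compared at the proximal point of \<open>x\<^sup>k\<close>, shows that the
  envelope decreases in conditional mean by a multiple of \<open>\<parallel>\<nabla>\<psi>\<^bsub>1/\<rho>\<^esub>(x\<^sup>k)\<parallel>\<^sup>2 / \<gamma>\<^sub>k\<close>, up to an error
  of order \<open>(Lip(x\<^sup>k, \<xi>\<^sup>k) + L\<^sub>\<omega>)\<^sup>2 / \<gamma>\<^sub>k\<^sup>2\<close>.  Since \<open>\<gamma>\<^sub>k\<close> is at least \<open>\<surd>K\<close> times the reference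
  constant at an independent sample, the mean error is \<open>O(1/K)\<close>, and so the mean of the envelope stays bounded
  during \<open>K\<close> steps.  Markov's inequality makes each iterate leave the ball with probability at most
  \<open>\<delta>\<close>, and Markov's inequality for the number of such iterates gives the events considered.  Inside
  the ball \<open>\<gamma>\<^sub>k\<close> is bounded by the supremum of the Lipschitz constants, so the accumulated decrease
  bounds the gradients there.
\<close>

section \<open>Strong convexity and the Moreau envelope\<close>

text \<open>The sample entering the step size must be independent of the one in the model: averaging
  over \<open>\<xi> k\<close> with \<open>x k\<close> and \<open>\<gamma> k\<close> frozen is what
  turns the model into \<open>f\<close>. The extra sample still tracks the Lipschitz constant, as
  (Lip(x,s) + L) / max(Lip(x,s'), \<alpha>) is at most (\<alpha> + L + |Lip(x,s) - Lip(x,s')|) /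
  \<alpha>, whose second moment is at most ((\<alpha> + \<sigma> + L) / \<alpha>)^2 at every
  reference point. This is the origin of that constant, and no upper bound on \<open>Lip\<close>
  enters before the ball does. Two lower bounds of the envelope are subtracted from it: -\<Lambda>
  for the probability of leaving the ball, which explains \<Delta>, and the infimum of \<psi> for
  the gradients, which explains D. Means of such nonnegative differences are taken in
  \<open>ennreal\<close>, so that integrability of the envelope along the run need not be known
  beforehand. The averaging needs a product law, hence measurable iterates: the subproblem has a
  unique minimizer, which depends measurably on its data, and \<open>x k\<close> becomes a function
  of earlier samples only. Conditioning divides by the probability of the event, which is at least
  (p - 2 \<delta>) / (2 p); this yields the factor in front.\<close>

definition strongly_convex_on :: "'a::real_inner set \<Rightarrow> real \<Rightarrow> ('a \<Rightarrow> real) \<Rightarrow> bool" where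
  "strongly_convex_on S \<mu> h \<longleftrightarrow> convex S \<and>
     (\<forall>x\<in>S. \<forall>y\<in>S. \<forall>t. 0 < t \<and> t < 1 \<longrightarrow>
        h ((1 - t) *\<^sub>R x + t *\<^sub>R y)
          \<le> (1 - t) * h x + t * h y - \<mu> / 2 * (t * (1 - t)) * (norm (x - y))\<^sup>2)"

text \<open>Stewart's identity. It is an equality, so a quadratic of either sign has its modulus
  exactly, and the errors of the model at two end points recombine without loss.\<close>

lemma norm_convex_combination:
  fixes x y z :: "'a::real_inner"
  shows "(norm ((1 - t) *\<^sub>R x + t *\<^sub>R y - z))\<^sup>2
    = (1 - t) * (norm (x - z))\<^sup>2 + t * (norm (y - z))\<^sup>2 - t * (1 - t) * (norm (x - y))\<^sup>2"
  unfolding power2_norm_eq_inner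
  by (simp add: inner_diff_left inner_diff_right inner_add_left inner_add_right inner_commute
      algebra_simps power2_eq_square)

lemma strongly_convex_onD:
  assumes "strongly_convex_on S \<mu> h" "x \<in> S" "y \<in> S" "0 < t" "t < 1"
  shows "h ((1 - t) *\<^sub>R x + t *\<^sub>R y)
    \<le> (1 - t) * h x + t * h y - \<mu> / 2 * (t * (1 - t)) * (norm (x - y))\<^sup>2"
  using assms unfolding strongly_convex_on_def by blast

text \<open>The moduli may have any sign. A negative one expresses weak convexity, so this single
  rule shows how a quadratic term compensates weak convexity.\<close>

lemma strongly_convex_on_add:
  assumes "strongly_convex_on S \<mu> h" "strongly_convex_on S \<nu> k"
  shows "strongly_convex_on S (\<mu> + \<nu>) (\<lambda>x. h x + k x)"
  unfolding strongly_convex_on_def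
proof (intro conjI ballI allI impI)
  show "convex S"
    using assms(1) by (simp add: strongly_convex_on_def)
next
  fix x y t assume *: "x \<in> S" "y \<in> S" "0 < t \<and> (t::real) < 1"
  show "h ((1 - t) *\<^sub>R x + t *\<^sub>R y) + k ((1 - t) *\<^sub>R x + t *\<^sub>R y)
    \<le> (1 - t) * (h x + k x) + t * (h y + k y) - (\<mu> + \<nu>) / 2 * (t * (1 - t)) * (norm (x - y))\<^sup>2"
    using strongly_convex_onD[OF assms(1), of x y t] strongly_convex_onD[OF assms(2), of x y t] *
    by (simp add: algebra_simps add_divide_distrib)
qed

lemma strongly_convex_on_quadratic:
  "convex S \<Longrightarrow> strongly_convex_on S c (\<lambda>y. c / 2 * (norm (y - x))\<^sup>2)"
  unfolding strongly_convex_on_def norm_convex_combination by (auto simp: field_simps)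

lemma convex_on_imp_strongly_convex_on:
  assumes "convex_on S (\<lambda>y. h y - \<mu> / 2 * (norm y)\<^sup>2)"
  shows "strongly_convex_on S \<mu> h"
  unfolding strongly_convex_on_def
proof (intro conjI ballI allI impI)
  show "convex S"
    using assms by (simp add: convex_on_def)
next
  fix x y t assume *: "x \<in> S" "y \<in> S" "0 < t \<and> (t::real) < 1"
  define c where "c = (1 - t) *\<^sub>R x + t *\<^sub>R y"
  have "h c - \<mu> / 2 * (norm c)\<^sup>2
      \<le> (1 - t) * (h x - \<mu> / 2 * (norm x)\<^sup>2) + t * (h y - \<mu> / 2 * (norm y)\<^sup>2)"
    using * convex_onD[OF assms, of t x y] by (simp add: c_def)
  moreover have "\<mu> / 2 * (norm c)\<^sup>2
      = \<mu> / 2 * ((1 - t) * (norm x)\<^sup>2 + t * (norm y)\<^sup>2 - t * (1 - t) * (norm (x - y))\<^sup>2)"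
    using norm_convex_combination[of t x y 0] by (simp add: c_def)
  ultimately have "h c \<le> (1 - t) * h x + t * h y - \<mu> / 2 * (t * (1 - t)) * (norm (x - y))\<^sup>2"
    by (simp add: algebra_simps add_divide_distrib diff_divide_distrib)
  then show "h ((1 - t) *\<^sub>R x + t *\<^sub>R y)
    \<le> (1 - t) * h x + t * h y - \<mu> / 2 * (t * (1 - t)) * (norm (x - y))\<^sup>2"
    by (simp add: c_def)
qed

text \<open>Minimality is compared with points of the segment from \<open>x\<close> to
  \<open>y\<close>; after division by \<open>t\<close>, the factor 1 - t in front of the quadratic
  tends to 1 as \<open>t\<close> decreases to 0.\<close>

lemma strongly_convex_on_minimizer_gap:
  assumes h: "strongly_convex_on S \<mu> h" and x: "x \<in> S" and min: "\<And>y. y \<in> S \<Longrightarrow> h x \<le> h y"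
    and y: "y \<in> S"
  shows "h x + \<mu> / 2 * (norm (y - x))\<^sup>2 \<le> h y"
proof -
  have "h x + \<mu> / 2 * (1 - t) * (norm (y - x))\<^sup>2 \<le> h y" if t: "0 < t" "t < 1" for t
  proof -
    have "(1 - t) *\<^sub>R x + t *\<^sub>R y \<in> S"
      using h x y t unfolding strongly_convex_on_def by (simp add: convexD)
    then have "t * (h x + \<mu> / 2 * (1 - t) * (norm (y - x))\<^sup>2) \<le> t * h y"
      using min[of "(1 - t) *\<^sub>R x + t *\<^sub>R y"] strongly_convex_onD[OF h x y t]
      by (simp add: algebra_simps norm_minus_commute)
    then show ?thesis
      using t by simp
  qed
  then have "\<forall>\<^sub>F t in at_right 0. h x + \<mu> / 2 * (1 - t) * (norm (y - x))\<^sup>2 \<le> h y"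
    by (auto intro: eventually_mono[OF eventually_at_right_real[of 0 "1::real"]])
  moreover have "((\<lambda>t::real. h x + \<mu> / 2 * (1 - t) * (norm (y - x))\<^sup>2)
      \<longlongrightarrow> h x + \<mu> / 2 * (1 - 0) * (norm (y - x))\<^sup>2) (at_right 0)"
    by (intro tendsto_intros)
  ultimately show ?thesis
    by (auto dest: tendsto_upperbound)
qed

text \<open>A minimizing sequence is Cauchy by strong convexity. Lower semicontinuity is required as
  a continuous minorant on \<open>S\<close> touching \<open>h\<close> at the given point, which is
  the form in which the model provides it for \<open>f\<close>.\<close>

lemma strongly_convex_on_minimizer_exists:
  fixes h :: "'a::euclidean_space \<Rightarrow> real"
  assumes h: "strongly_convex_on S \<mu> h" and mu: "0 < \<mu>" and S: "closed S" "S \<noteq> {}"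
    and bdd: "\<And>y. y \<in> S \<Longrightarrow> m \<le> h y"
    and lsc: "\<And>y. y \<in> S \<Longrightarrow> \<exists>r. continuous_on S r \<and> r y = h y \<and> (\<forall>z\<in>S. r z \<le> h z)"
  shows "\<exists>y\<in>S. \<forall>z\<in>S. h y \<le> h z"
proof -
  define I where "I = Inf (h ` S)"
  have bb: "bdd_below (h ` S)"
    using bdd by (rule bdd_belowI2)
  have I: "I \<le> h y" if "y \<in> S" for y
    unfolding I_def using that bb by (simp add: cInf_lower)
  have "\<exists>y\<in>S. h y < I + 1 / real (Suc n)" for n
    using cInf_lessD[of "h ` S" "I + 1 / real (Suc n)"] S by (auto simp: I_def)
  then obtain u where u: "u n \<in> S" "h (u n) < I + 1 / real (Suc n)" for n
    by metis
  \<comment> \<open>At the midpoint the value is at least I, while strong convexity puts it \<mu>/8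
    times the squared distance below the average of the two values.\<close>
  have dist: "\<mu> / 4 * (norm (u n - u k))\<^sup>2 \<le> 1 / real (Suc n) + 1 / real (Suc k)" for n k
  proof -
    have "(1 - 1/2) *\<^sub>R u n + (1/2) *\<^sub>R u k \<in> S"
      using h u unfolding strongly_convex_on_def by (intro convexD) auto
    then show ?thesis
      using I[of "(1 - 1/2) *\<^sub>R u n + (1/2) *\<^sub>R u k"] u(2)[of n] u(2)[of k]
        strongly_convex_onD[OF h u(1)[of n] u(1)[of k], of "1/2"] by simp
  qed
  have "Cauchy u"
  proof (rule CauchyI)
    fix e :: real assume "0 < e"
    have "0 < \<mu> * e\<^sup>2 / 8"
      using mu \<open>0 < e\<close> by simp
    then obtain N where N: "1 / real (Suc N) < \<mu> * e\<^sup>2 / 8"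
      using nat_approx_posE by blast
    have "norm (u m - u n) < e" if "N \<le> m" "N \<le> n" for m n
    proof -
      have "1 / real (Suc m) \<le> 1 / real (Suc N)" "1 / real (Suc n) \<le> 1 / real (Suc N)"
        using that by (auto intro!: divide_left_mono)
      then have "\<mu> / 4 * (norm (u m - u n))\<^sup>2 < \<mu> / 4 * e\<^sup>2"
        using dist[of m n] N by linarith
      then have "(norm (u m - u n))\<^sup>2 < e\<^sup>2"
        using mu by simp
      then show ?thesis
        using \<open>0 < e\<close> by (auto intro: power2_less_imp_less)
    qed
    then show "\<exists>N. \<forall>m\<ge>N. \<forall>n\<ge>N. norm (u m - u n) < e"
      by blast
  qed
  then obtain y where y: "u \<longlonglongrightarrow> y"
    using Cauchy_convergent convergent_def by blast
  then have yS: "y \<in> S"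
    using S(1) u(1) closed_sequentially by blast
  obtain r where r: "continuous_on S r" "r y = h y" "\<And>z. z \<in> S \<Longrightarrow> r z \<le> h z"
    using lsc[OF yS] by blast
  have "(\<lambda>n. r (u n)) \<longlonglongrightarrow> r y"
    using continuous_on_tendsto_compose[OF r(1) y yS] u(1) by simp
  moreover have "(\<lambda>n. I + 1 / real (Suc n)) \<longlonglongrightarrow> I + 0"
    by (intro tendsto_intros LIMSEQ_Suc lim_1_over_n)
  moreover have "r (u n) \<le> I + 1 / real (Suc n)" for n
    using r(3)[OF u(1)[of n]] u(2)[of n] by linarith
  ultimately have "h y \<le> I"
    using r(2) by (auto intro: LIMSEQ_le)
  then have "h y \<le> h z" if "z \<in> S" for z
    using I[OF that] by simp
  then show ?thesis
    using yS by blast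
qed

text \<open>Existence of proximal points is an assumption here, so that the calculus of the envelope
  depends only on minimality and on \<eta> < \<rho>.\<close>

locale proximal_map =
  fixes S :: "'a::euclidean_space set" and h :: "'a \<Rightarrow> real" and \<eta> \<rho> :: real and prox :: "'a \<Rightarrow> 'a"
  assumes weakly_convex: "strongly_convex_on S (- \<eta>) h"
    and eta: "0 \<le> \<eta>" "\<eta> < \<rho>"
    and prox_in: "\<And>x. prox x \<in> S"
    and prox_min: "\<And>x z. z \<in> S \<Longrightarrow>
      h (prox x) + \<rho> / 2 * (norm (prox x - x))\<^sup>2 \<le> h z + \<rho> / 2 * (norm (z - x))\<^sup>2"
begin

definition env :: "'a \<Rightarrow> real" where
  "env x = h (prox x) + \<rho> / 2 * (norm (prox x - x))\<^sup>2"

lemma env_le: "z \<in> S \<Longrightarrow> env x \<le> h z + \<rho> / 2 * (norm (z - x))\<^sup>2"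
  unfolding env_def by (rule prox_min)

lemma env_gap:
  assumes "z \<in> S"
  shows "env x + (\<rho> - \<eta>) / 2 * (norm (z - prox x))\<^sup>2 \<le> h z + \<rho> / 2 * (norm (z - x))\<^sup>2"
proof -
  have "convex S"
    using weakly_convex by (simp add: strongly_convex_on_def)
  then have "strongly_convex_on S (- \<eta> + \<rho>) (\<lambda>z. h z + \<rho> / 2 * (norm (z - x))\<^sup>2)"
    by (intro strongly_convex_on_add weakly_convex strongly_convex_on_quadratic)
  from strongly_convex_on_minimizer_gap[OF this prox_in[of x] prox_min assms] show ?thesis
    by (simp add: env_def)
qed

text \<open>Adding the two gap inequalities in which each proximal point is tested against the
  problem of the other cancels the values of \<open>h\<close> and leaves an inner product, to which
  Cauchy-Schwarz applies.\<close>

lemma prox_lipschitz: "norm (prox x - prox y) \<le> \<rho> / (\<rho> - \<eta>) * norm (x - y)"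
proof (cases "prox x = prox y")
  case False
  have "(\<rho> - \<eta>) * (norm (prox x - prox y))\<^sup>2 \<le> \<rho> * ((prox x - prox y) \<bullet> (x - y))"
    using env_gap[OF prox_in[of y], of x] env_gap[OF prox_in[of x], of y]
    unfolding env_def power2_norm_eq_inner
    by (simp add: inner_diff_left inner_diff_right inner_commute field_simps)
  also have "\<dots> \<le> \<rho> * (norm (prox x - prox y) * norm (x - y))"
    using eta norm_cauchy_schwarz[of "prox x - prox y" "x - y"] by simp
  finally have "norm (prox x - prox y) * ((\<rho> - \<eta>) * norm (prox x - prox y))
      \<le> norm (prox x - prox y) * (\<rho> * norm (x - y))"
    by (simp add: power2_eq_square algebra_simps)
  then have "(\<rho> - \<eta>) * norm (prox x - prox y) \<le> \<rho> * norm (x - y)"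
    using False by simp
  then show ?thesis
    using eta by (simp add: field_simps)
qed (use eta in simp)

lemma continuous_prox: "continuous_on UNIV prox"
proof (rule lipschitz_on_continuous_on)
  show "(\<rho> / (\<rho> - \<eta>))-lipschitz_on UNIV prox"
    using prox_lipschitz eta by (intro lipschitz_onI) (auto simp: dist_norm)
qed

lemma env_upper: "env y \<le> env x + \<rho> * ((x - prox x) \<bullet> (y - x)) + \<rho> / 2 * (norm (y - x))\<^sup>2"
  using env_le[OF prox_in[of x], of y] unfolding env_def[of x] power2_norm_eq_inner
  by (simp add: inner_diff_left inner_diff_right inner_commute algebra_simps)

text \<open>This is \<open>env_upper\<close> with the two points exchanged; replacing the gradient
  at \<open>y\<close> by that at \<open>x\<close> costs the Lipschitz constant of
  \<open>prox\<close>.\<close>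

lemma env_lower:
  "env x + \<rho> * ((x - prox x) \<bullet> (y - x)) - (\<rho> / 2 + \<rho> * (\<rho> / (\<rho> - \<eta>))) * (norm (y - x))\<^sup>2 \<le> env y"
proof -
  have "env x \<le> env y + \<rho> * ((y - prox y) \<bullet> (x - y)) + \<rho> / 2 * (norm (x - y))\<^sup>2"
    by (rule env_upper)
  also have "\<rho> * ((y - prox y) \<bullet> (x - y)) = - (\<rho> * ((x - prox x) \<bullet> (y - x)))
      - \<rho> * (norm (y - x))\<^sup>2 + \<rho> * ((prox y - prox x) \<bullet> (y - x))"
    unfolding power2_norm_eq_inner
    by (simp add: inner_diff_left inner_diff_right inner_commute algebra_simps)
  finally have "env x + \<rho> * ((x - prox x) \<bullet> (y - x)) + \<rho> * (norm (y - x))\<^sup>2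
      - \<rho> / 2 * (norm (y - x))\<^sup>2 - \<rho> * ((prox y - prox x) \<bullet> (y - x)) \<le> env y"
    by (simp add: norm_minus_commute)
  moreover have "(prox y - prox x) \<bullet> (y - x) \<le> \<rho> / (\<rho> - \<eta>) * (norm (y - x))\<^sup>2"
    using norm_cauchy_schwarz[of "prox y - prox x" "y - x"]
      mult_right_mono[OF prox_lipschitz[of y x], of "norm (y - x)"]
    by (simp add: power2_eq_square mult.assoc)
  then have "\<rho> * ((prox y - prox x) \<bullet> (y - x)) \<le> \<rho> * (\<rho> / (\<rho> - \<eta>) * (norm (y - x))\<^sup>2)"
    using eta by (intro mult_left_mono) auto
  moreover have "0 \<le> \<rho> * (norm (y - x))\<^sup>2"
    using eta by simp
  ultimately show ?thesis
    by (simp add: algebra_simps)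
qed

text \<open>The envelope lies between two quadratics with the same value and slope at
  \<open>x\<close>, so the remainder is of second order. The larger of the two curvature constants
  serves both sides.\<close>

lemma GDERIV_env: "GDERIV env x :> \<rho> *\<^sub>R (x - prox x)"
  unfolding gderiv_def
proof (rule has_derivativeI_sandwich[of 1])
  show "bounded_linear (\<lambda>h. h \<bullet> (\<rho> *\<^sub>R (x - prox x)))"
    by (rule bounded_linear_inner_left)
  define c where "c = \<rho> / 2 + \<rho> * (\<rho> / (\<rho> - \<eta>))"
  have c: "\<rho> / 2 \<le> c"
    using eta by (simp add: c_def)
  show "norm (env y - env x - (y - x) \<bullet> (\<rho> *\<^sub>R (x - prox x))) / norm (y - x) \<le> c * norm (y - x)"
    if "y \<noteq> x" for y
  proof -
    have "\<rho> / 2 * (norm (y - x))\<^sup>2 \<le> c * (norm (y - x))\<^sup>2"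
      using c by (rule mult_right_mono) simp
    then have "norm (env y - env x - (y - x) \<bullet> (\<rho> *\<^sub>R (x - prox x))) \<le> c * (norm (y - x))\<^sup>2"
      using env_upper[of y x] env_lower[of x y] unfolding c_def[symmetric]
      by (simp add: inner_commute abs_le_iff)
    then show ?thesis
      using that by (simp add: divide_le_eq power2_eq_square mult.assoc)
  qed
  have "((\<lambda>y. c * norm (y - x)) \<longlongrightarrow> c * norm (x - x)) (at x)"
    by (intro tendsto_intros)
  then show "((\<lambda>y. c * norm (y - x)) \<longlongrightarrow> 0) (at x)"
    by simp
qed simp

lemma gradient_env: "gradient env x = \<rho> *\<^sub>R (x - prox x)"
  unfolding gradient_def
proof (rule the_equality)
  show "GDERIV env x :> \<rho> *\<^sub>R (x - prox x)"
    by (rule GDERIV_env)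
next
  fix d assume "GDERIV env x :> d"
  then have "(\<lambda>h. h \<bullet> d) = (\<lambda>h. h \<bullet> (\<rho> *\<^sub>R (x - prox x)))"
    using GDERIV_env unfolding gderiv_def by (rule has_derivative_unique)
  then show "d = \<rho> *\<^sub>R (x - prox x)"
    by (metis inner_commute vector_eq_ldot)
qed

lemma continuous_env: "continuous_on UNIV env"
  using GDERIV_env unfolding gderiv_def
  by (auto intro!: continuous_at_imp_continuous_on has_derivative_continuous)

end

section \<open>Stochastic models\<close>

text \<open>The minimizer is the limit of approximate minimizers chosen from a countable dense set; strong
  convexity turns almost minimal values into proximity to the minimizer.\<close>

lemma measurable_strong_minimizer:
  fixes C :: "'a::euclidean_space set" and \<phi> :: "'b \<Rightarrow> 'a \<Rightarrow> real"
  assumes meas: "\<And>y. y \<in> C \<Longrightarrow> (\<lambda>b. \<phi> b y) \<in> borel_measurable N"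
    and cont: "\<And>b. b \<in> space N \<Longrightarrow> continuous_on C (\<phi> b)"
    and t: "\<And>b. b \<in> space N \<Longrightarrow> t b \<in> C"
    and mu: "\<And>b. b \<in> space N \<Longrightarrow> 0 < \<mu> b"
    and gap: "\<And>b z. b \<in> space N \<Longrightarrow> z \<in> C \<Longrightarrow> \<phi> b (t b) + \<mu> b * (norm (z - t b))\<^sup>2 \<le> \<phi> b z"
  shows "t \<in> measurable N (restrict_space borel C)"
proof (cases "space N = {}")
  case True
  then show ?thesis
    by (simp add: measurable_def space_restrict_space sets_eq_bot space_empty_iff)
next
  case False
  then have "C \<noteq> {}"
    using t by blast
  obtain D where D: "countable D" "D \<subseteq> C" "C \<subseteq> closure D"
    using separable by blast
  then have "D \<noteq> {}"
    using \<open>C \<noteq> {}\<close> by auto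
  define q where "q = from_nat_into D"
  have q: "q i \<in> C" for i
    using D(2) from_nat_into[OF \<open>D \<noteq> {}\<close>, of i] by (auto simp: q_def)
  have q_surj: "\<exists>i. q i = d" if "d \<in> D" for d
    using from_nat_into_surj[OF D(1) that] by (simp add: q_def)
  have approx: "\<exists>i. \<phi> b (q i) < c" if b: "b \<in> space N" and c: "\<phi> b (t b) < c" for b c
  proof -
    obtain u where u: "\<And>n. u n \<in> D" "u \<longlonglongrightarrow> t b"
      using D(3) t[OF b] closure_sequential by blast
    then have "(\<lambda>n. \<phi> b (u n)) \<longlonglongrightarrow> \<phi> b (t b)"
      using D(2) t[OF b] u by (intro continuous_on_tendsto_compose[OF cont[OF b]] always_eventually) auto
    then have "\<forall>\<^sub>F n in sequentially. \<phi> b (u n) < c"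
      using c by (rule order_tendstoD(2))
    then obtain n where "\<phi> b (u n) < c"
      by (auto simp: eventually_sequentially)
    then show ?thesis
      using q_surj[OF u(1)[of n]] by metis
  qed
  have min: "\<phi> b (t b) \<le> \<phi> b z" if "b \<in> space N" "z \<in> C" for b z
    using gap[OF that] mult_nonneg_nonneg[OF less_imp_le[OF mu[OF that(1)]] zero_le_power2[of "norm (z - t b)"]]
    by linarith
  have V: "(\<lambda>b. \<phi> b (t b)) \<in> borel_measurable N"
    unfolding borel_measurable_iff_less
  proof
    fix c
    have "{b \<in> space N. \<phi> b (t b) < c} = (\<Union>i. {b \<in> space N. \<phi> b (q i) < c})"
      using approx le_less_trans[OF min[OF _ q]] by auto
    also have "\<dots> \<in> sets N"
      using meas[OF q] by measurable
    finally show "{b \<in> space N. \<phi> b (t b) < c} \<in> sets N" .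
  qed
  \<comment> \<open>Taking the first admissible index makes the choice measurable: the index is a
    \<open>LEAST\<close> over measurable conditions, and \<open>q\<close> maps a discrete
    space.\<close>
  define y where "y n b = q (LEAST i. \<phi> b (q i) < \<phi> b (t b) + 1 / real (Suc n))" for n b
  have "y n \<in> borel_measurable N" for n
  proof -
    have [measurable]: "(\<lambda>b. \<phi> b (q i)) \<in> borel_measurable N" "(\<lambda>b. \<phi> b (t b)) \<in> borel_measurable N" for i
      using meas[OF q] V by auto
    have "(\<lambda>b. LEAST i. \<phi> b (q i) < \<phi> b (t b) + 1 / real (Suc n)) \<in> measurable N (count_space UNIV)"
      by measurable
    then show ?thesis
      unfolding y_def by (rule measurable_compose) simp
  qed
  moreover have "(\<lambda>n. y n b) \<longlonglongrightarrow> t b" if b: "b \<in> space N" for b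
  proof -
    have y: "\<phi> b (y n b) < \<phi> b (t b) + 1 / real (Suc n)" for n
    proof -
      have "\<exists>i. \<phi> b (q i) < \<phi> b (t b) + 1 / real (Suc n)"
        by (rule approx[OF b]) simp
      then show ?thesis
        unfolding y_def by (rule LeastI_ex)
    qed
    define e where "e n = 1 / \<mu> b * (1 / real (Suc n))" for n
    have "norm ((norm (y n b - t b))\<^sup>2) \<le> e n" for n
    proof -
      have "y n b \<in> C"
        by (simp add: y_def q)
      then have "\<mu> b * (norm (y n b - t b))\<^sup>2 \<le> 1 / real (Suc n)"
        using gap[OF b, of "y n b"] y[of n] by linarith
      then show ?thesis
        using mu[OF b] by (simp add: e_def pos_le_divide_eq mult_ac)
    qed
    then have "\<forall>\<^sub>F n in sequentially. norm ((norm (y n b - t b))\<^sup>2) \<le> e n"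
      by simp
    moreover have "e \<longlonglongrightarrow> 0"
      unfolding e_def by (rule tendsto_mult_right_zero[OF LIMSEQ_Suc[OF lim_1_over_n]])
    ultimately have "(\<lambda>n. (norm (y n b - t b))\<^sup>2) \<longlonglongrightarrow> 0"
      by (rule Lim_null_comparison)
    then have "(\<lambda>n. sqrt ((norm (y n b - t b))\<^sup>2)) \<longlonglongrightarrow> sqrt 0"
      by (rule tendsto_real_sqrt)
    then show ?thesis
      by (simp add: LIM_zero_iff tendsto_norm_zero_iff)
  qed
  ultimately have "t \<in> borel_measurable N"
    by (rule borel_measurable_LIMSEQ_metric)
  then show ?thesis
    using t by (intro measurable_restrict_space2) auto
qed

text \<open>Minkowski's inequality in L2 for a constant plus \<open>Y\<close>, derived from 2 a y <=
  a \<sigma> + (a / \<sigma>) y^2. This form of Young's inequality is sharp at y = \<sigma>, hence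
  the bound is the exact square.\<close>

lemma nn_integral_power2_add_le:
  fixes Y :: "'s \<Rightarrow> real"
  assumes "prob_space N" and [measurable]: "Y \<in> borel_measurable N"
    and Y: "\<And>s. s \<in> space N \<Longrightarrow> 0 \<le> Y s" and a: "0 \<le> a" "0 \<le> \<sigma>"
    and bound: "(\<integral>\<^sup>+ s. ennreal ((Y s)\<^sup>2) \<partial>N) \<le> ennreal (\<sigma>\<^sup>2)"
  shows "(\<integral>\<^sup>+ s. ennreal ((a + Y s)\<^sup>2) \<partial>N) \<le> ennreal ((a + \<sigma>)\<^sup>2)"
proof -
  interpret prob_space N by fact
  show ?thesis
  \<comment> \<open>Young's inequality divides by \<sigma>; for \<sigma> = 0 the variable vanishes
    almost everywhere.\<close>
  proof (cases "\<sigma> = 0")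
    case True
    then have "(\<integral>\<^sup>+ s. ennreal ((Y s)\<^sup>2) \<partial>N) = 0"
      using bound by simp
    then have "AE s in N. ennreal ((Y s)\<^sup>2) = 0"
      by (subst (asm) nn_integral_0_iff_AE) auto
    then have "(\<integral>\<^sup>+ s. ennreal ((a + Y s)\<^sup>2) \<partial>N) = (\<integral>\<^sup>+ s. ennreal (a\<^sup>2) \<partial>N)"
      by (intro nn_integral_cong_AE) auto
    then show ?thesis
      using True by (simp add: emeasure_space_1)
  next
    case False
    then have s: "0 < \<sigma>"
      using a by simp
    have "(a + y)\<^sup>2 \<le> (a\<^sup>2 + a * \<sigma>) + (1 + a / \<sigma>) * y\<^sup>2" for y
    proof -
      have "0 \<le> a / \<sigma> * (y - \<sigma>)\<^sup>2"
        using a s by simp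
      also have "\<dots> = (a\<^sup>2 + a * \<sigma>) + (1 + a / \<sigma>) * y\<^sup>2 - (a + y)\<^sup>2"
        using s by (simp add: field_simps power2_eq_square)
      finally show ?thesis
        by simp
    qed
    then have "(\<integral>\<^sup>+ s. ennreal ((a + Y s)\<^sup>2) \<partial>N)
        \<le> (\<integral>\<^sup>+ s. ennreal (a\<^sup>2 + a * \<sigma>) + ennreal (1 + a / \<sigma>) * ennreal ((Y s)\<^sup>2) \<partial>N)"
      using a s by (intro nn_integral_mono)
        (simp add: ennreal_mult[symmetric] ennreal_plus[symmetric] ennreal_leI del: ennreal_plus)
    also have "\<dots> = ennreal (a\<^sup>2 + a * \<sigma>) + ennreal (1 + a / \<sigma>) * (\<integral>\<^sup>+ s. ennreal ((Y s)\<^sup>2) \<partial>N)"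
      by (simp add: nn_integral_add nn_integral_cmult emeasure_space_1)
    also have "\<dots> \<le> ennreal (a\<^sup>2 + a * \<sigma>) + ennreal (1 + a / \<sigma>) * ennreal (\<sigma>\<^sup>2)"
      by (intro add_left_mono mult_left_mono bound) simp
    also have "\<dots> = ennreal ((a\<^sup>2 + a * \<sigma>) + (1 + a / \<sigma>) * \<sigma>\<^sup>2)"
      using a s by (simp add: ennreal_mult[symmetric] ennreal_plus[symmetric] del: ennreal_plus)
    also have "(a\<^sup>2 + a * \<sigma>) + (1 + a / \<sigma>) * \<sigma>\<^sup>2 = (a + \<sigma>)\<^sup>2"
      using s by (simp add: field_simps power2_eq_square)
    finally show ?thesis .
  qed
qed

text \<open>The extended-valued regularizer is represented by its domain \<open>C\<close> and a real
  function \<open>w\<close> on it. The infinite values are thereby turned into constraints, and the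
  analysis stays within the reals.\<close>

locale stochastic_model = prob_space \<Xi> for \<Xi> :: "'s measure" +
  fixes C :: "'a::euclidean_space set" and w f :: "'a \<Rightarrow> real"
    and fm :: "'a \<Rightarrow> 'a \<Rightarrow> 's \<Rightarrow> real" and Lip :: "'a \<Rightarrow> 's \<Rightarrow> real" and \<kappa> \<tau> \<sigma> L \<rho> :: real
  assumes C: "closed C" "C \<noteq> {}"
    and w_weakly_convex: "strongly_convex_on C (- \<kappa>) w"
    and w_lipschitz: "L-lipschitz_on C w"
    and constants: "0 \<le> \<kappa>" "0 \<le> \<tau>" "0 \<le> \<sigma>" "\<kappa> + \<tau> < \<rho>"
    and measurable_model: "measurable_model \<Xi> C fm Lip"
    and model: "model_condition \<Xi> C f \<tau> fm"
    and reference: "reference_lipschitz \<Xi> C fm Lip \<sigma>"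
    and bounded_below: "\<exists>m. \<forall>z\<in>C. m \<le> f z + w z"
begin

lemma L_nonneg: "0 \<le> L"
  using w_lipschitz by (rule lipschitz_on_nonneg)

lemma rho_pos: "0 < \<rho>"
  using constants by simp

lemma convex_C: "convex C"
  using w_weakly_convex by (simp add: strongly_convex_on_def)

lemma w_diff: "x \<in> C \<Longrightarrow> y \<in> C \<Longrightarrow> \<bar>w x - w y\<bar> \<le> L * norm (x - y)"
  using w_lipschitz lipschitz_onD[of L C w x y] by (simp add: dist_norm)

lemma fm_diff: "x \<in> C \<Longrightarrow> s \<in> space \<Xi> \<Longrightarrow> \<bar>fm x y s - fm x z s\<bar> \<le> Lip x s * norm (y - z)"
  using reference unfolding reference_lipschitz_def
  by (auto simp: abs_le_iff) (metis norm_minus_commute)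

lemma fm_integrable: "x \<in> C \<Longrightarrow> y \<in> C \<Longrightarrow> integrable \<Xi> (fm x y)"
  using model unfolding model_condition_def by blast

lemma fm_reference: "x \<in> C \<Longrightarrow> (\<integral>s. fm x x s \<partial>\<Xi>) = f x"
  using model unfolding model_condition_def by blast

lemma fm_accuracy:
  assumes "x \<in> C" "y \<in> C"
  shows "(\<integral>s. fm x y s \<partial>\<Xi>) \<le> f y + \<tau> / 2 * (norm (x - y))\<^sup>2"
proof -
  have "(\<integral>s. fm x y s - f y \<partial>\<Xi>) \<le> \<tau> / 2 * (norm (x - y))\<^sup>2"
    using model assms unfolding model_condition_def by blast
  moreover have "(\<integral>s. fm x y s - f y \<partial>\<Xi>) = (\<integral>s. fm x y s \<partial>\<Xi>) - f y"
    using fm_integrable[OF assms] by (simp add: prob_space)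
  ultimately show ?thesis
    by simp
qed

lemma fm_convex: "x \<in> C \<Longrightarrow> s \<in> space \<Xi> \<Longrightarrow> convex_on C (\<lambda>y. fm x y s)"
  using model unfolding model_condition_def by blast

lemma measurable_Lip_pair [measurable]:
  "(\<lambda>(x, s). Lip x s) \<in> borel_measurable (restrict_space borel C \<Otimes>\<^sub>M \<Xi>)"
  using measurable_model unfolding measurable_model_def by blast

lemma measurable_Lip_compose [measurable (raw)]:
  assumes "X \<in> measurable N (restrict_space borel C)" "Y \<in> measurable N \<Xi>"
  shows "(\<lambda>v. Lip (X v) (Y v)) \<in> borel_measurable N"
  using measurable_compose[OF measurable_Pair[OF assms] measurable_Lip_pair] by simp

lemma measurable_const_C: "x \<in> C \<Longrightarrow> (\<lambda>_. x) \<in> measurable N (restrict_space borel C)"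
  by (simp add: space_restrict_space)

lemma measurable_fm_compose:
  assumes "X \<in> measurable N (restrict_space borel C)" "y \<in> C" "Y \<in> measurable N \<Xi>"
  shows "(\<lambda>v. fm (X v) y (Y v)) \<in> borel_measurable N"
proof -
  have "(\<lambda>(x, y, s). fm x y s)
      \<in> borel_measurable (restrict_space borel C \<Otimes>\<^sub>M restrict_space borel C \<Otimes>\<^sub>M \<Xi>)"
    using measurable_model unfolding measurable_model_def by blast
  from measurable_compose[OF measurable_Pair[OF assms(1)
        measurable_Pair[OF measurable_const_C[OF assms(2)] assms(3)]] this]
  show ?thesis by simp
qed

lemma measurable_Lip: "x \<in> C \<Longrightarrow> Lip x \<in> borel_measurable \<Xi>"
  using measurable_Lip_compose[OF measurable_const_C, of x "\<lambda>s. s" \<Xi>] by simp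

text \<open>Two points at distance one bound \<open>Lip x s\<close> below by an absolute value; they
  may lie outside \<open>C\<close> because the reference Lipschitz condition ranges over all
  arguments.\<close>

lemma Lip_nonneg:
  assumes "x \<in> C" "s \<in> space \<Xi>"
  shows "0 \<le> Lip x s"
proof -
  obtain b :: 'a where "norm b = 1"
    using SOME_Basis norm_Basis by blast
  then show ?thesis
    using fm_diff[OF assms, of b 0] by simp
qed

lemma Lip_variance:
  assumes x: "x \<in> C"
  shows "(\<integral>\<^sup>+ s'. \<integral>\<^sup>+ s. ennreal (\<bar>Lip x s - Lip x s'\<bar>\<^sup>2) \<partial>\<Xi> \<partial>\<Xi>) \<le> ennreal (\<sigma>\<^sup>2)"
proof -
  note [measurable] = measurable_Lip[OF x]
  have "(\<integral>\<^sup>+ s'. \<integral>\<^sup>+ s. ennreal (\<bar>Lip x s' - Lip x s\<bar>\<^sup>2) \<partial>\<Xi> \<partial>\<Xi>)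
      = (\<integral>\<^sup>+ (s', s). ennreal (\<bar>Lip x s' - Lip x s\<bar>\<^sup>2) \<partial>(\<Xi> \<Otimes>\<^sub>M \<Xi>))"
    by (subst nn_integral_fst[symmetric]) (auto simp: case_prod_beta)
  also have "\<dots> \<le> ennreal (\<sigma>\<^sup>2)"
    using reference x unfolding reference_lipschitz_def by blast
  finally show ?thesis
    by (simp add: abs_minus_commute)
qed

text \<open>Only differences of \<open>Lip\<close> at two samples are controlled by assumption. By
  finiteness of the double integral, some fixed sample has a square integrable difference from the
  others, and \<open>Lip x\<close> differs from that difference by a constant.\<close>

lemma Lip_integrable:
  assumes x: "x \<in> C"
  shows "integrable \<Xi> (Lip x)"
proof -
  note [measurable] = measurable_Lip[OF x]
  have "AE s' in \<Xi>. (\<integral>\<^sup>+ s. ennreal (\<bar>Lip x s - Lip x s'\<bar>\<^sup>2) \<partial>\<Xi>) \<noteq> \<infinity>"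
    using Lip_variance[OF x] by (intro nn_integral_noteq_infinite) (auto simp: top_unique)
  \<comment> \<open>A probability measure has a nontrivial almost-everywhere filter, so a property
    holding almost everywhere is attained at a point of the space.\<close>
  then have "\<exists>\<^sub>F s' in ae_filter \<Xi>. s' \<in> space \<Xi> \<and> (\<integral>\<^sup>+ s. ennreal (\<bar>Lip x s - Lip x s'\<bar>\<^sup>2) \<partial>\<Xi>) \<noteq> \<infinity>"
    using AE_space[of \<Xi>]
    by (intro eventually_frequently eventually_conj) (auto simp: ae_filter_eq_bot_iff emeasure_space_1)
  then obtain s' where s': "s' \<in> space \<Xi>" "(\<integral>\<^sup>+ s. ennreal (\<bar>Lip x s - Lip x s'\<bar>\<^sup>2) \<partial>\<Xi>) \<noteq> \<infinity>"
    by (auto dest: frequently_ex)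
  have "integrable \<Xi> (\<lambda>s. \<bar>Lip x s - Lip x s'\<bar>\<^sup>2)"
    using s'(2) by (intro integrableI_bounded) (auto simp: less_top)
  then have "integrable \<Xi> (\<lambda>s. \<bar>Lip x s'\<bar> + 1 + \<bar>Lip x s - Lip x s'\<bar>\<^sup>2)"
    by simp
  then show ?thesis
  proof (rule Bochner_Integration.integrable_bound)
    have "\<bar>a\<bar> \<le> \<bar>b\<bar> + 1 + \<bar>a - b\<bar>\<^sup>2" for a b :: real
    proof -
      have "0 \<le> (\<bar>a - b\<bar> - 1/2)\<^sup>2"
        by simp
      then have "\<bar>a - b\<bar> \<le> 1 + \<bar>a - b\<bar>\<^sup>2"
        by (simp add: power2_eq_square algebra_simps)
      then show ?thesis
        by linarith
    qed
    then show "AE s in \<Xi>. norm (Lip x s) \<le> norm (\<bar>Lip x s'\<bar> + 1 + \<bar>Lip x s - Lip x s'\<bar>\<^sup>2)"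
      by (auto simp: abs_le_iff)
  qed simp
qed

text \<open>The model is taken with the convex combination itself as reference point: it is exact
  there, convex between the end points, and exceeds \<open>f\<close> at these by at most \<tau>/2
  times squared distances. By Stewart's identity the weighted errors add up to the permitted
  defect.\<close>

lemma f_weakly_convex: "strongly_convex_on C (- \<tau>) f"
  unfolding strongly_convex_on_def
proof (intro conjI ballI allI impI)
  show "convex C"
    by (rule convex_C)
next
  fix x y t assume x: "x \<in> C" and y: "y \<in> C" and t: "0 < t \<and> (t::real) < 1"
  define c where "c = (1 - t) *\<^sub>R x + t *\<^sub>R y"
  have c: "c \<in> C"
    using convexD[OF convex_C x y] t by (simp add: c_def)
  have "f c = (\<integral>s. fm c c s \<partial>\<Xi>)"
    using fm_reference[OF c] by simp
  also have "\<dots> \<le> (\<integral>s. (1 - t) * fm c x s + t * fm c y s \<partial>\<Xi>)"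
  proof (rule integral_mono)
    fix s assume "s \<in> space \<Xi>"
    from convex_onD[OF fm_convex[OF c this], of t x y]
    show "fm c c s \<le> (1 - t) * fm c x s + t * fm c y s"
      using t x y by (simp add: c_def)
  qed (auto intro!: fm_integrable c x y Bochner_Integration.integrable_add integrable_mult_right)
  also have "\<dots> = (1 - t) * (\<integral>s. fm c x s \<partial>\<Xi>) + t * (\<integral>s. fm c y s \<partial>\<Xi>)"
    using fm_integrable[OF c x] fm_integrable[OF c y] by simp
  also have "\<dots> \<le> (1 - t) * (f x + \<tau> / 2 * (norm (c - x))\<^sup>2) + t * (f y + \<tau> / 2 * (norm (c - y))\<^sup>2)"
    using t fm_accuracy[OF c x] fm_accuracy[OF c y] by (intro add_mono mult_left_mono) auto
  also have "\<dots> = (1 - t) * f x + t * f y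
      + \<tau> / 2 * ((1 - t) * (norm (x - c))\<^sup>2 + t * (norm (y - c))\<^sup>2)"
    by (simp add: field_simps norm_minus_commute)
  also have "(1 - t) * (norm (x - c))\<^sup>2 + t * (norm (y - c))\<^sup>2 = t * (1 - t) * (norm (x - y))\<^sup>2"
    using norm_convex_combination[of t x y c] by (simp add: c_def)
  finally show "f ((1 - t) *\<^sub>R x + t *\<^sub>R y)
      \<le> (1 - t) * f x + t * f y - (- \<tau>) / 2 * (t * (1 - t)) * (norm (x - y))\<^sup>2"
    by (simp add: c_def)
qed

text \<open>Lower semicontinuity of \<open>f\<close> in a quantitative form: the mean Lipschitz
  constant of the model at \<open>x\<close> and its accuracy give a continuous minorant touching
  \<open>f\<close> at \<open>x\<close>.\<close>

lemma f_support:
  assumes x: "x \<in> C" and y: "y \<in> C"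
  shows "f x - (\<integral>s. Lip x s \<partial>\<Xi>) * norm (y - x) - \<tau> / 2 * (norm (y - x))\<^sup>2 \<le> f y"
proof -
  have "f x = (\<integral>s. fm x x s \<partial>\<Xi>)"
    using fm_reference[OF x] by simp
  also have "\<dots> \<le> (\<integral>s. fm x y s + Lip x s * norm (y - x) \<partial>\<Xi>)"
  proof (rule integral_mono)
    fix s assume "s \<in> space \<Xi>"
    from fm_diff[OF x this, of x y] show "fm x x s \<le> fm x y s + Lip x s * norm (y - x)"
      by (simp add: norm_minus_commute)
  qed (auto intro!: fm_integrable x y Lip_integrable)
  also have "\<dots> = (\<integral>s. fm x y s \<partial>\<Xi>) + (\<integral>s. Lip x s \<partial>\<Xi>) * norm (y - x)"
    using fm_integrable[OF x y] Lip_integrable[OF x] by simp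
  finally show ?thesis
    using fm_accuracy[OF x y] by (simp add: norm_minus_commute)
qed

lemma psi_weakly_convex: "strongly_convex_on C (- (\<kappa> + \<tau>)) (\<lambda>z. f z + w z)"
  using strongly_convex_on_add[OF f_weakly_convex w_weakly_convex] by (simp add: algebra_simps)

definition prox :: "'a \<Rightarrow> 'a" where
  "prox x = (SOME y. y \<in> C \<and>
    (\<forall>z\<in>C. f y + w y + \<rho> / 2 * (norm (y - x))\<^sup>2 \<le> f z + w z + \<rho> / 2 * (norm (z - x))\<^sup>2))"

lemma prox_minimizer:
  "prox x \<in> C \<and> (\<forall>z\<in>C. f (prox x) + w (prox x) + \<rho> / 2 * (norm (prox x - x))\<^sup>2
      \<le> f z + w z + \<rho> / 2 * (norm (z - x))\<^sup>2)"
  unfolding prox_def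
proof (rule someI_ex)
  let ?h = "\<lambda>z. f z + w z + \<rho> / 2 * (norm (z - x))\<^sup>2"
  obtain m where m: "\<And>z. z \<in> C \<Longrightarrow> m \<le> f z + w z"
    using bounded_below by blast
  have "\<exists>y\<in>C. \<forall>z\<in>C. ?h y \<le> ?h z"
  proof (rule strongly_convex_on_minimizer_exists)
    show "strongly_convex_on C (- (\<kappa> + \<tau>) + \<rho>) ?h"
      by (intro strongly_convex_on_add psi_weakly_convex strongly_convex_on_quadratic convex_C)
    show "0 < - (\<kappa> + \<tau>) + \<rho>"
      using constants by simp
    show "m \<le> ?h z" if "z \<in> C" for z
      using m[OF that] rho_pos by (simp add: add_increasing2)
  next
    fix y assume y: "y \<in> C"
    show "\<exists>r. continuous_on C r \<and> r y = ?h y \<and> (\<forall>z\<in>C. r z \<le> ?h z)"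
    proof (intro exI conjI ballI)
      \<comment> \<open>The minorant of the objective replaces \<open>f\<close> by its support at
        \<open>y\<close> and keeps the remaining terms, which are continuous on
        \<open>C\<close>.\<close>
      let ?r = "\<lambda>z. f y - (\<integral>s. Lip y s \<partial>\<Xi>) * norm (z - y) - \<tau> / 2 * (norm (z - y))\<^sup>2 + w z
        + \<rho> / 2 * (norm (z - x))\<^sup>2"
      show "continuous_on C ?r"
        by (intro continuous_intros lipschitz_on_continuous_on[OF w_lipschitz])
      show "?r y = ?h y"
        by simp
      show "?r z \<le> ?h z" if "z \<in> C" for z
        using f_support[OF y that] by simp
    qed
  qed (use C in auto)
  then show "\<exists>y. y \<in> C \<and> (\<forall>z\<in>C. ?h y \<le> ?h z)"
    by blast
qed

sublocale proximal_map C "\<lambda>z. f z + w z" "\<kappa> + \<tau>" \<rho> prox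
  using psi_weakly_convex constants prox_minimizer by unfold_locales auto

end

section \<open>One step of the algorithm\<close>

context stochastic_model begin

definition model_prox :: "'a \<Rightarrow> real \<Rightarrow> 's \<Rightarrow> 'a" where
  "model_prox x g s = (SOME y. y \<in> C \<and>
    (\<forall>z\<in>C. fm x y s + w y + g / 2 * (norm (y - x))\<^sup>2 \<le> fm x z s + w z + g / 2 * (norm (z - x))\<^sup>2))"

lemma continuous_subproblem:
  assumes "x \<in> C" "s \<in> space \<Xi>"
  shows "continuous_on C (\<lambda>y. fm x y s + w y + g / 2 * (norm (y - x))\<^sup>2)"
proof -
  have "(Lip x s)-lipschitz_on C (\<lambda>y. fm x y s)"
    using fm_diff[OF assms] Lip_nonneg[OF assms] by (auto intro!: lipschitz_onI simp: dist_norm)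
  then show ?thesis
    by (intro continuous_intros lipschitz_on_continuous_on[OF w_lipschitz] lipschitz_on_continuous_on)
qed

lemma strongly_convex_subproblem:
  assumes "x \<in> C" "s \<in> space \<Xi>"
  shows "strongly_convex_on C (g - \<kappa>) (\<lambda>y. fm x y s + w y + g / 2 * (norm (y - x))\<^sup>2)"
proof -
  have "strongly_convex_on C 0 (\<lambda>y. fm x y s)"
    using fm_convex[OF assms] by (intro convex_on_imp_strongly_convex_on) simp
  from strongly_convex_on_add[OF strongly_convex_on_add[OF this w_weakly_convex]
      strongly_convex_on_quadratic[OF convex_C]] show ?thesis
    by (simp add: algebra_simps)
qed

lemma model_prox_minimizer:
  assumes x: "x \<in> C" and s: "s \<in> space \<Xi>" and g: "\<kappa> < g"
  shows "model_prox x g s \<in> C \<and> (\<forall>z\<in>C. fm x (model_prox x g s) s + w (model_prox x g s) + g / 2 * (norm (model_prox x g s - x))\<^sup>2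
      \<le> fm x z s + w z + g / 2 * (norm (z - x))\<^sup>2)"
  unfolding model_prox_def
proof (rule someI_ex)
  let ?h = "\<lambda>z. fm x z s + w z + g / 2 * (norm (z - x))\<^sup>2"
  have g0: "0 < g"
    using g constants by simp
  have "\<exists>y\<in>C. \<forall>z\<in>C. ?h y \<le> ?h z"
  proof (rule strongly_convex_on_minimizer_exists)
    show "strongly_convex_on C (g - \<kappa>) ?h"
      by (rule strongly_convex_subproblem[OF x s])
    show "0 < g - \<kappa>"
      using g by simp
    \<comment> \<open>Moving away from \<open>x\<close> lowers model plus regularizer by at most
      \<open>l\<close> per unit of length; completing the square against the proximal term bounds
      the objective below.\<close>
    define l where "l = Lip x s + L"
    show "fm x x s + w x - l\<^sup>2 / (2 * g) \<le> ?h z" if z: "z \<in> C" for z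
    proof -
      have "0 \<le> g / 2 * (norm (z - x) - l / g)\<^sup>2"
        using g0 by simp
      also have "\<dots> = g / 2 * (norm (z - x))\<^sup>2 - l * norm (z - x) + l\<^sup>2 / (2 * g)"
        using g0 by (simp add: field_simps power2_eq_square)
      finally have "l * norm (z - x) - l\<^sup>2 / (2 * g) \<le> g / 2 * (norm (z - x))\<^sup>2"
        by simp
      then show ?thesis
        using fm_diff[OF x s, of z x] w_diff[OF z x] by (simp add: l_def algebra_simps)
    qed
  next
    fix y assume y: "y \<in> C"
    show "\<exists>r. continuous_on C r \<and> r y = ?h y \<and> (\<forall>z\<in>C. r z \<le> ?h z)"
      using continuous_subproblem[OF x s] by (intro exI[of _ ?h]) simp
  qed (use C in auto)
  then show "\<exists>y. y \<in> C \<and> (\<forall>z\<in>C. ?h y \<le> ?h z)"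
    by blast
qed

lemma model_prox_gap:
  assumes x: "x \<in> C" and s: "s \<in> space \<Xi>" and g: "\<kappa> < g" and z: "z \<in> C"
  shows "fm x (model_prox x g s) s + w (model_prox x g s) + g / 2 * (norm (model_prox x g s - x))\<^sup>2
      + (g - \<kappa>) / 2 * (norm (z - model_prox x g s))\<^sup>2 \<le> fm x z s + w z + g / 2 * (norm (z - x))\<^sup>2"
  using strongly_convex_on_minimizer_gap[OF strongly_convex_subproblem[OF x s, of g] _ _ z]
    model_prox_minimizer[OF x s g] by blast

text \<open>This identifies the iterates of an arbitrary run with the selected minimizer, and
  thereby makes them random variables.\<close>

lemma model_prox_unique:
  assumes x: "x \<in> C" and s: "s \<in> space \<Xi>" and g: "\<kappa> < g" and y: "y \<in> C"
    and min: "fm x y s + w y + g / 2 * (norm (y - x))\<^sup>2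
      \<le> fm x (model_prox x g s) s + w (model_prox x g s) + g / 2 * (norm (model_prox x g s - x))\<^sup>2"
  shows "y = model_prox x g s"
proof -
  have "(g - \<kappa>) / 2 * (norm (y - model_prox x g s))\<^sup>2 \<le> 0"
    using model_prox_gap[OF x s g y] min by simp
  then show ?thesis
    using g by (simp add: mult_le_0_iff)
qed

lemma measurable_model_prox:
  assumes X: "X \<in> measurable N (restrict_space borel C)" and Y: "Y \<in> measurable N \<Xi>"
    and g [measurable]: "g \<in> borel_measurable N" and gk: "\<And>v. v \<in> space N \<Longrightarrow> \<kappa> < g v"
  shows "(\<lambda>v. model_prox (X v) (g v) (Y v)) \<in> measurable N (restrict_space borel C)"
proof (rule measurable_strong_minimizer)
  have X_in: "X v \<in> C" if "v \<in> space N" for v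
    using measurable_space[OF X that] by (simp add: space_restrict_space)
  note Y_in = measurable_space[OF Y]
  show "(\<lambda>v. fm (X v) y (Y v) + w y + g v / 2 * (norm (y - X v))\<^sup>2) \<in> borel_measurable N"
    if "y \<in> C" for y
  proof -
    note [measurable] = measurable_fm_compose[OF X that Y]
    have [measurable]: "X \<in> borel_measurable N"
      using X by (simp add: measurable_restrict_space2_iff)
    show ?thesis
      by measurable
  qed
  fix v assume v: "v \<in> space N"
  show "continuous_on C (\<lambda>y. fm (X v) y (Y v) + w y + g v / 2 * (norm (y - X v))\<^sup>2)"
    by (rule continuous_subproblem[OF X_in[OF v] Y_in[OF v]])
  show "model_prox (X v) (g v) (Y v) \<in> C"
    using model_prox_minimizer[OF X_in[OF v] Y_in[OF v] gk[OF v]] by blast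
  show "0 < (g v - \<kappa>) / 2"
    using gk[OF v] by simp
  fix z assume "z \<in> C"
  from model_prox_gap[OF X_in[OF v] Y_in[OF v] gk[OF v] this]
  show "fm (X v) (model_prox (X v) (g v) (Y v)) (Y v) + w (model_prox (X v) (g v) (Y v))
      + g v / 2 * (norm (model_prox (X v) (g v) (Y v) - X v))\<^sup>2
      + (g v - \<kappa>) / 2 * (norm (z - model_prox (X v) (g v) (Y v)))\<^sup>2
    \<le> fm (X v) z (Y v) + w z + g v / 2 * (norm (z - X v))\<^sup>2" .
qed

text \<open>The new envelope value is tested at \<open>prox x\<close>, and the squared distance from
  the new iterate to \<open>prox x\<close> is bounded by the gap of the subproblem there. The point
  \<open>prox x\<close> does not depend on \<open>s\<close>, so the model values on the right can be
  averaged by the model conditions. The proximal term of the new iterate absorbs the Lipschitz loss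
  by completing the square.\<close>

lemma env_step_pointwise:
  assumes x: "x \<in> C" and s: "s \<in> space \<Xi>" and g: "\<kappa> < g"
  shows "env (model_prox x g s) \<le> f (prox x) + w (prox x) + \<rho> / (g - \<kappa>) * (fm x (prox x) s - fm x x s
    + w (prox x) - w x + g / 2 * (norm (prox x - x))\<^sup>2 + (Lip x s + L)\<^sup>2 / (2 * g))"
proof -
  define y where "y = model_prox x g s"
  define l where "l = Lip x s + L"
  have g0: "0 < g"
    using g constants by simp
  have y: "y \<in> C"
    using model_prox_minimizer[OF x s g] by (simp add: y_def)
  have "0 \<le> g / 2 * (norm (y - x) - l / g)\<^sup>2"
    using g0 by simp
  also have "\<dots> = g / 2 * (norm (y - x))\<^sup>2 - l * norm (y - x) + l\<^sup>2 / (2 * g)"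
    using g0 by (simp add: field_simps power2_eq_square)
  finally have "l * norm (y - x) - g / 2 * (norm (y - x))\<^sup>2 \<le> l\<^sup>2 / (2 * g)"
    by simp
  moreover have "fm x x s + w x - l * norm (y - x) \<le> fm x y s + w y"
    using fm_diff[OF x s, of y x] w_diff[OF y x] by (simp add: l_def algebra_simps)
  moreover have "fm x y s + w y + g / 2 * (norm (y - x))\<^sup>2 + (g - \<kappa>) / 2 * (norm (prox x - y))\<^sup>2
      \<le> fm x (prox x) s + w (prox x) + g / 2 * (norm (prox x - x))\<^sup>2"
    using model_prox_gap[OF x s g prox_in] by (simp add: y_def)
  ultimately have "(g - \<kappa>) / 2 * (norm (prox x - y))\<^sup>2 \<le> fm x (prox x) s - fm x x s
      + w (prox x) - w x + g / 2 * (norm (prox x - x))\<^sup>2 + l\<^sup>2 / (2 * g)"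
    by simp
  then have "\<rho> / (g - \<kappa>) * ((g - \<kappa>) / 2 * (norm (prox x - y))\<^sup>2) \<le> \<rho> / (g - \<kappa>) * (fm x (prox x) s
      - fm x x s + w (prox x) - w x + g / 2 * (norm (prox x - x))\<^sup>2 + l\<^sup>2 / (2 * g))"
    using rho_pos g by (intro mult_left_mono) auto
  moreover have "\<rho> / (g - \<kappa>) * ((g - \<kappa>) / 2 * (norm (prox x - y))\<^sup>2) = \<rho> / 2 * (norm (prox x - y))\<^sup>2"
    using g by simp
  ultimately show ?thesis
    using env_le[OF prox_in[of x], of y] unfolding y_def l_def by linarith
qed

text \<open>Here \<open>q\<close> stands for the square root of the number of steps, and
  \<open>s\<close> is the extra sample, not the one used in the model.\<close>

definition stepsize :: "real \<Rightarrow> real \<Rightarrow> 'a \<Rightarrow> 's \<Rightarrow> real" where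
  "stepsize \<alpha> q x s = \<rho> + \<tau> + \<kappa> + max (Lip x s) \<alpha> * q"

lemma stepsize_gt:
  assumes "0 < \<alpha>" "0 < q"
  shows "\<kappa> < stepsize \<alpha> q x s"
proof -
  have "0 < max (Lip x s) \<alpha> * q"
    using assms by simp
  then show ?thesis
    using constants by (simp add: stepsize_def)
qed

text \<open>The reference constant at the independent sample \<open>s'\<close> controls the one at \<open>s\<close> up to the
  relative error \<open>(\<alpha> + L + \<bar>Lip x s - Lip x s'\<bar>) / \<alpha>\<close>, whose second moment is bounded.\<close>

lemma stepsize_noise:
  fixes s' :: 's
  assumes x: "x \<in> C" and s: "s \<in> space \<Xi>" and a: "0 < \<alpha>" and q: "0 < q"
  defines "g \<equiv> stepsize \<alpha> q x s'"
  shows "\<rho> / (g - \<kappa>) * ((Lip x s + L)\<^sup>2 / (2 * g))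
    \<le> \<rho> / (2 * q\<^sup>2 * \<alpha>\<^sup>2) * (\<alpha> + L + \<bar>Lip x s - Lip x s'\<bar>)\<^sup>2"
proof -
  define \<theta> where "\<theta> = max (Lip x s') \<alpha>"
  define N where "N = \<alpha> + L + \<bar>Lip x s - Lip x s'\<bar>"
  have th: "\<alpha> \<le> \<theta>" "Lip x s' \<le> \<theta>" "0 < \<theta>"
    using a by (auto simp: \<theta>_def)
  have g: "\<theta> * q \<le> g - \<kappa>" "\<theta> * q \<le> g"
    using constants by (auto simp: g_def stepsize_def \<theta>_def)
  \<comment> \<open>The constant at \<open>s\<close> is split into the one at \<open>s'\<close>,
    which is at most \<theta>, and a difference; since \<alpha> <= \<theta>, the factor \<alpha> of
    the difference and of L may be raised to \<theta>.\<close>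
  have "\<alpha> * (Lip x s + L) \<le> \<alpha> * \<theta> + \<alpha> * (\<bar>Lip x s - Lip x s'\<bar> + L)"
    using a th(2) by (simp add: distrib_left[symmetric])
  also have "\<dots> \<le> \<theta> * \<alpha> + \<theta> * (\<bar>Lip x s - Lip x s'\<bar> + L)"
    using th L_nonneg by (intro add_mono mult_right_mono) auto
  also have "\<dots> = \<theta> * N"
    by (simp add: N_def algebra_simps)
  finally have "\<alpha> * (Lip x s + L) \<le> \<theta> * N" .
  then have "(\<alpha> * (Lip x s + L))\<^sup>2 \<le> (\<theta> * N)\<^sup>2"
    using a Lip_nonneg[OF x s] L_nonneg by (intro power_mono) auto
  then have "(Lip x s + L)\<^sup>2 \<le> (\<theta> * N)\<^sup>2 / \<alpha>\<^sup>2"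
    using a by (simp add: pos_le_divide_eq power_mult_distrib mult.commute)
  moreover have pos: "0 < \<theta> * q"
    using th q by simp
  moreover have "\<rho> / (g - \<kappa>) * ((Lip x s + L)\<^sup>2 / (2 * g))
      \<le> \<rho> / (\<theta> * q) * ((Lip x s + L)\<^sup>2 / (2 * (\<theta> * q)))"
  proof (rule mult_mono)
    show "\<rho> / (g - \<kappa>) \<le> \<rho> / (\<theta> * q)"
      using g pos rho_pos by (intro divide_left_mono) auto
    show "(Lip x s + L)\<^sup>2 / (2 * g) \<le> (Lip x s + L)\<^sup>2 / (2 * (\<theta> * q))"
      using g pos by (intro divide_left_mono) auto
  qed (use pos g rho_pos in auto)
  moreover have "\<rho> / (\<theta> * q) * ((Lip x s + L)\<^sup>2 / (2 * (\<theta> * q)))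
      \<le> \<rho> / (\<theta> * q) * ((\<theta> * N)\<^sup>2 / \<alpha>\<^sup>2 / (2 * (\<theta> * q)))"
    using calculation(1) th q rho_pos by (intro mult_left_mono divide_right_mono) auto
  moreover have "\<rho> / (\<theta> * q) * ((\<theta> * N)\<^sup>2 / \<alpha>\<^sup>2 / (2 * (\<theta> * q))) = \<rho> / (2 * q\<^sup>2 * \<alpha>\<^sup>2) * N\<^sup>2"
    using th q a by (simp add: field_simps power2_eq_square)
  ultimately show ?thesis
    unfolding N_def by linarith
qed

text \<open>The pointwise inequality is averaged over the model sample with \<open>s'\<close>
  frozen. The gradient term stands on the left and \<open>m\<close> is subtracted on both sides, so
  that all terms are nonnegative and the inequality can be integrated again without integrability
  conditions.\<close>

lemma env_step:
  fixes s' :: 's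
  assumes x: "x \<in> C" and a: "0 < \<alpha>" and q: "0 < q" and m: "\<And>y. m \<le> env y"
  defines "g \<equiv> stepsize \<alpha> q x s'"
  shows "(\<integral>\<^sup>+ s. ennreal (env (model_prox x g s) - m) \<partial>\<Xi>)
      + ennreal ((\<rho> - \<tau> - \<kappa>) / (\<rho> * (g - \<kappa>)) * (norm (gradient env x))\<^sup>2)
    \<le> ennreal (env x - m) + ennreal (\<rho> / (2 * q\<^sup>2 * \<alpha>\<^sup>2))
      * (\<integral>\<^sup>+ s. ennreal ((\<alpha> + L + \<bar>Lip x s - Lip x s'\<bar>)\<^sup>2) \<partial>\<Xi>)"
proof -
  define c where "c = \<rho> / (2 * q\<^sup>2 * \<alpha>\<^sup>2)"
  define N where "N s = (\<alpha> + L + \<bar>Lip x s - Lip x s'\<bar>)\<^sup>2" for s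
  define d where "d = (norm (prox x - x))\<^sup>2"
  have c: "0 < c"
    using rho_pos a q by (simp add: c_def)
  note [measurable] = measurable_Lip[OF x]
  have g: "\<kappa> < g"
    unfolding g_def by (rule stepsize_gt[OF a q])
  have grad: "(\<rho> - \<tau> - \<kappa>) / (\<rho> * (g - \<kappa>)) * (norm (gradient env x))\<^sup>2 = (\<rho> - \<tau> - \<kappa>) * \<rho> / (g - \<kappa>) * d"
  proof -
    have "(norm (gradient env x))\<^sup>2 = \<rho>\<^sup>2 * d"
      unfolding gradient_env norm_scaleR power_mult_distrib d_def by (simp add: norm_minus_commute)
    then show ?thesis
      using rho_pos g by (simp add: field_simps power2_eq_square)
  qed
  have grad_nonneg: "0 \<le> (\<rho> - \<tau> - \<kappa>) * \<rho> / (g - \<kappa>) * d"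
    using rho_pos g constants by (auto simp: d_def)
  show ?thesis
  \<comment> \<open>An infinite noise integral makes the right side infinite; otherwise
    \<open>N\<close> is integrable and real integrals are available.\<close>
  proof (cases "(\<integral>\<^sup>+ s. ennreal (N s) \<partial>\<Xi>) = \<infinity>")
    case True
    then show ?thesis
      using c unfolding c_def[symmetric] N_def[symmetric] by (simp add: ennreal_mult_top)
  next
    case False
    have N_meas [measurable]: "N \<in> borel_measurable \<Xi>"
      unfolding N_def by measurable
    have N_int: "integrable \<Xi> N"
      using False by (intro integrableI_bounded) (auto simp: less_top N_def)
    define W where "W s = f (prox x) + w (prox x) - m + \<rho> / (g - \<kappa>) * (fm x (prox x) s - fm x x s
      + (w (prox x) - w x + g / 2 * d)) + c * N s" for s
    have fmi: "integrable \<Xi> (fm x (prox x))" "integrable \<Xi> (fm x x)"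
      using fm_integrable x prox_in by auto
    have W_int: "integrable \<Xi> W"
      unfolding W_def using N_int fmi
      by (intro Bochner_Integration.integrable_add integrable_mult_right
          Bochner_Integration.integrable_diff) auto
    have W: "env (model_prox x g s) - m \<le> W s" if s: "s \<in> space \<Xi>" for s
    proof -
      have eq: "fm x (prox x) s - fm x x s + w (prox x) - w x + g / 2 * d + (Lip x s + L)\<^sup>2 / (2 * g)
        = (fm x (prox x) s - fm x x s + (w (prox x) - w x + g / 2 * d)) + (Lip x s + L)\<^sup>2 / (2 * g)"
        by simp
      have "env (model_prox x g s) \<le> f (prox x) + w (prox x) + (\<rho> / (g - \<kappa>) * (fm x (prox x) s - fm x x s
          + (w (prox x) - w x + g / 2 * d)) + \<rho> / (g - \<kappa>) * ((Lip x s + L)\<^sup>2 / (2 * g)))"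
        using env_step_pointwise[OF x s g]
        unfolding d_def[symmetric] eq distrib_left[of "\<rho> / (g - \<kappa>)" _ "(Lip x s + L)\<^sup>2 / (2 * g)"] .
      moreover have "\<rho> / (g - \<kappa>) * ((Lip x s + L)\<^sup>2 / (2 * g)) \<le> c * N s"
        using stepsize_noise[OF x s a q] by (simp add: g_def c_def N_def)
      ultimately show ?thesis
        unfolding W_def by linarith
    qed
    have W_nonneg: "0 \<le> W s" if "s \<in> space \<Xi>" for s
      using W[OF that] m[of "model_prox x g s"] by simp
    have "(\<integral>\<^sup>+ s. ennreal (env (model_prox x g s) - m) \<partial>\<Xi>) \<le> (\<integral>\<^sup>+ s. ennreal (W s) \<partial>\<Xi>)"
      using W by (intro nn_integral_mono ennreal_leI) auto
    also have "\<dots> = ennreal (\<integral>s. W s \<partial>\<Xi>)"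
      using W_int W_nonneg by (intro nn_integral_eq_integral) auto
    finally have 1: "(\<integral>\<^sup>+ s. ennreal (env (model_prox x g s) - m) \<partial>\<Xi>) \<le> ennreal (\<integral>s. W s \<partial>\<Xi>)" .
    have "(\<integral>s. W s \<partial>\<Xi>) = f (prox x) + w (prox x) - m + \<rho> / (g - \<kappa>) * ((\<integral>s. fm x (prox x) s \<partial>\<Xi>) - f x
      + (w (prox x) - w x + g / 2 * d)) + c * (\<integral>s. N s \<partial>\<Xi>)"
      unfolding W_def using N_int fmi fm_reference[OF x] by (simp add: prob_space)
    also have "\<dots> \<le> f (prox x) + w (prox x) - m + \<rho> / (g - \<kappa>) * ((g - \<kappa>) / 2 * d - (\<rho> - \<tau> - \<kappa>) * d)
        + c * (\<integral>s. N s \<partial>\<Xi>)"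
    \<comment> \<open>The gap of the envelope at \<open>x\<close> tested against \<open>x\<close>
      itself and the accuracy of the model at \<open>prox x\<close> combine here. Of the resulting
      coefficient, the part (g - \<kappa>)/2 becomes \<rho>/2 after multiplication and restores the
      envelope at \<open>x\<close>; the rest is the decrease.\<close>
    proof (intro add_mono mult_left_mono order_refl)
      have "env x + (\<rho> - (\<kappa> + \<tau>)) / 2 * d \<le> f x + w x"
        using env_gap[OF x, of x] by (simp add: d_def norm_minus_commute)
      then have "f (prox x) + w (prox x) + \<rho> / 2 * d + (\<rho> - (\<kappa> + \<tau>)) / 2 * d \<le> f x + w x"
        by (simp add: env_def d_def)
      moreover have "(\<integral>s. fm x (prox x) s \<partial>\<Xi>) \<le> f (prox x) + \<tau> / 2 * d"
        using fm_accuracy[OF x prox_in, of x] by (simp add: d_def norm_minus_commute)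
      ultimately have "(\<integral>s. fm x (prox x) s \<partial>\<Xi>) - f x + (w (prox x) - w x + g / 2 * d)
        \<le> \<tau> / 2 * d - \<rho> / 2 * d - (\<rho> - (\<kappa> + \<tau>)) / 2 * d + g / 2 * d"
        by simp
      also have "\<dots> = (g - \<kappa>) / 2 * d - (\<rho> - \<tau> - \<kappa>) * d"
        by (simp add: field_simps)
      finally show "(\<integral>s. fm x (prox x) s \<partial>\<Xi>) - f x + (w (prox x) - w x + g / 2 * d)
        \<le> (g - \<kappa>) / 2 * d - (\<rho> - \<tau> - \<kappa>) * d" .
    qed (use rho_pos g c in auto)
    also have "\<dots> = env x - m - (\<rho> - \<tau> - \<kappa>) * \<rho> / (g - \<kappa>) * d + c * (\<integral>s. N s \<partial>\<Xi>)"
      using g by (simp add: env_def d_def field_simps)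
    finally have 2: "(\<integral>s. W s \<partial>\<Xi>) + (\<rho> - \<tau> - \<kappa>) * \<rho> / (g - \<kappa>) * d
        \<le> env x - m + c * (\<integral>s. N s \<partial>\<Xi>)"
      by simp
    have "0 \<le> (\<integral>s. W s \<partial>\<Xi>)" "0 \<le> (\<integral>s. N s \<partial>\<Xi>)"
      using W_nonneg by (auto intro!: integral_nonneg_AE simp: N_def)
    then have "ennreal (\<integral>s. W s \<partial>\<Xi>) + ennreal ((\<rho> - \<tau> - \<kappa>) * \<rho> / (g - \<kappa>) * d)
        \<le> ennreal (env x - m) + ennreal c * ennreal (\<integral>s. N s \<partial>\<Xi>)"
      using grad_nonneg m[of x] c 2
      by (simp add: ennreal_mult[symmetric] ennreal_plus[symmetric] ennreal_leI del: ennreal_plus)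
    also have "ennreal (\<integral>s. N s \<partial>\<Xi>) = (\<integral>\<^sup>+ s. ennreal (N s) \<partial>\<Xi>)"
      by (rule nn_integral_eq_integral[OF N_int, symmetric]) (simp add: N_def)
    finally show ?thesis
      using 1 unfolding grad by (auto simp: c_def N_def intro: order_trans[OF add_right_mono])
  qed
qed

end

section \<open>Iterates as functions of independent samples\<close>

text \<open>Independence of two variables requires a common codomain, but \<open>f\<close> and \<open>g\<close> may map to
  different types, so the conclusion is stated as a product of laws.\<close>

lemma (in prob_space) indep_var_distr_compose:
  assumes "indep_var S X S' Y" and f: "f \<in> measurable S N" and g: "g \<in> measurable S' N'"
  shows "distr M N (\<lambda>v. f (X v)) \<Otimes>\<^sub>M distr M N' (\<lambda>v. g (Y v))
    = distr M (N \<Otimes>\<^sub>M N') (\<lambda>v. (f (X v), g (Y v)))"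
proof -
  note [measurable] = f g
  have [measurable]: "X \<in> measurable M S" "Y \<in> measurable M S'"
    and XY: "distr M S X \<Otimes>\<^sub>M distr M S' Y = distr M (S \<Otimes>\<^sub>M S') (\<lambda>v. (X v, Y v))"
    using assms(1) by (auto simp: indep_var_distribution_eq)
  interpret g: prob_space "distr M N' (\<lambda>v. g (Y v))"
    by (rule prob_space_distr) measurable
  have "distr M N (\<lambda>v. f (X v)) = distr (distr M S X) N f"
    "distr M N' (\<lambda>v. g (Y v)) = distr (distr M S' Y) N' g"
    by (simp_all add: distr_distr comp_def)
  then have "distr M N (\<lambda>v. f (X v)) \<Otimes>\<^sub>M distr M N' (\<lambda>v. g (Y v))
      = distr (distr M S X \<Otimes>\<^sub>M distr M S' Y) (N \<Otimes>\<^sub>M N') (\<lambda>(a, b). (f a, g b))"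
    using g.sigma_finite_measure_axioms by (simp add: pair_measure_distr)
  also have "\<dots> = distr M (N \<Otimes>\<^sub>M N') (\<lambda>v. (f (X v), g (Y v)))"
    unfolding XY by (subst distr_distr) (auto simp: comp_def)
  finally show ?thesis .
qed

locale model_run = stochastic_model \<Xi> C w f fm Lip \<kappa> \<tau> \<sigma> L \<rho> + M: prob_space M
  for \<Xi> :: "'s measure" and C :: "'a::euclidean_space set" and w f fm Lip \<kappa> \<tau> \<sigma> L \<rho>
    and M :: "'w measure" +
  fixes K :: nat and \<xi> \<xi>' :: "nat \<Rightarrow> 'w \<Rightarrow> 's" and \<alpha> :: real and x1 :: 'a and x :: "nat \<Rightarrow> 'w \<Rightarrow> 'a"
  assumes samples: "iid_samples M \<Xi> K \<xi> \<xi>'"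
    and K: "1 \<le> K" and alpha: "0 < \<alpha>" and x1: "x1 \<in> C"
    and x_first: "\<And>v. v \<in> space M \<Longrightarrow> x 1 v = x1"
    and x_Suc: "\<And>k v. k \<in> {1..K} \<Longrightarrow> v \<in> space M \<Longrightarrow>
      x (Suc k) v = model_prox (x k v) (stepsize \<alpha> (sqrt (real K)) (x k v) (\<xi>' k v)) (\<xi> k v)"
begin

abbreviation RC :: "'a measure" where "RC \<equiv> restrict_space borel C"

abbreviation step :: "'a \<Rightarrow> 's \<Rightarrow> 's \<Rightarrow> 'a" where
  "step y s' s \<equiv> model_prox y (stepsize \<alpha> (sqrt (real K)) y s') s"

lemma sqrt_K: "0 < sqrt (real K)"
  using K by simp

lemma measurable_stepsize [measurable (raw)]:
  assumes "X \<in> measurable N RC" "Y \<in> measurable N \<Xi>"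
  shows "(\<lambda>v. stepsize \<alpha> (sqrt (real K)) (X v) (Y v)) \<in> borel_measurable N"
  using measurable_Lip_compose[OF assms] unfolding stepsize_def by measurable

lemma measurable_step:
  assumes "X \<in> measurable N RC" "Y' \<in> measurable N \<Xi>" "Y \<in> measurable N \<Xi>"
  shows "(\<lambda>v. step (X v) (Y' v) (Y v)) \<in> measurable N RC"
  using assms by (intro measurable_model_prox measurable_stepsize stepsize_gt alpha sqrt_K)

text \<open>\<open>history_iterate k\<close> computes the iterate \<open>x\<close> of index \<open>k + 1\<close>; \<open>Inl\<close> and \<open>Inr\<close> mark the samples
  \<open>\<xi>\<close> and \<open>\<xi>'\<close>.\<close>

primrec history_iterate :: "nat \<Rightarrow> (nat + nat \<Rightarrow> 's) \<Rightarrow> 'a" where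
  "history_iterate 0 h = x1"
| "history_iterate (Suc k) h = step (history_iterate k h) (h (Inr (Suc k))) (h (Inl (Suc k)))"

abbreviation past :: "nat \<Rightarrow> (nat + nat) set" where "past k \<equiv> {1..k} <+> {1..k}"

text \<open>The index set may exceed the past, because the extra sample of the current step is
  adjoined to it when that block is separated from the model sample.\<close>

lemma measurable_history_iterate:
  "k \<le> n \<Longrightarrow> past n \<subseteq> A \<Longrightarrow> history_iterate k \<in> measurable (PiM A (\<lambda>_. \<Xi>)) RC"
proof (induction k)
  case 0
  have "history_iterate 0 = (\<lambda>_. x1)"
    by (simp add: fun_eq_iff)
  then show ?case
    using measurable_const_C[OF x1] by simp
next
  case (Suc k)
  have "Inr (Suc k) \<in> A" "Inl (Suc k) \<in> A"
    using Suc.prems by auto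
  then have "(\<lambda>h. step (history_iterate k h) (h (Inr (Suc k))) (h (Inl (Suc k))))
      \<in> measurable (PiM A (\<lambda>_. \<Xi>)) RC"
    using Suc by (intro measurable_step measurable_component_singleton) auto
  then show ?case
    by simp
qed

abbreviation sample :: "nat + nat \<Rightarrow> 'w \<Rightarrow> 's" where "sample \<equiv> case_sum \<xi> \<xi>'"

lemma x_history:
  "k \<le> n \<Longrightarrow> n \<le> K \<Longrightarrow> past n \<subseteq> A \<Longrightarrow> v \<in> space M \<Longrightarrow>
    x (Suc k) v = history_iterate k (restrict (\<lambda>i. sample i v) A)"
proof (induction k)
  case 0
  then show ?case
    using x_first by simp
next
  case (Suc k)
  have "Inr (Suc k) \<in> A" "Inl (Suc k) \<in> A"
    using Suc.prems by auto
  then show ?case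
    using Suc x_Suc[of "Suc k" v] by simp
qed

section \<open>Joint law of an iterate and the two samples of its step\<close>

lemma indep_samples: "M.indep_vars (\<lambda>_. \<Xi>) sample ({1..K} <+> {1..K})"
  using samples by (simp add: iid_samples_def)

lemma measurable_sample: "i \<in> {1..K} <+> {1..K} \<Longrightarrow> sample i \<in> measurable M \<Xi>"
  using indep_samples unfolding M.indep_vars_def by blast

lemma measurable_xi [measurable]: "k \<in> {1..K} \<Longrightarrow> \<xi> k \<in> measurable M \<Xi>" "k \<in> {1..K} \<Longrightarrow> \<xi>' k \<in> measurable M \<Xi>"
  using measurable_sample[OF InlI, of k] measurable_sample[OF InrI, of k] by simp_all

lemma distr_xi: "k \<in> {1..K} \<Longrightarrow> distr M \<Xi> (\<xi> k) = \<Xi>" "k \<in> {1..K} \<Longrightarrow> distr M \<Xi> (\<xi>' k) = \<Xi>"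
  using samples by (auto simp: iid_samples_def)

lemma measurable_x_Suc: "k \<le> K \<Longrightarrow> x (Suc k) \<in> measurable M RC"
proof (induction k)
  case 0
  show ?case
    using measurable_const_C[OF x1] x_first by (subst measurable_cong[of _ _ "\<lambda>_. x1"]) auto
next
  case (Suc k)
  then have k: "Suc k \<in> {1..K}"
    by simp
  have "(\<lambda>v. step (x (Suc k) v) (\<xi>' (Suc k) v) (\<xi> (Suc k) v)) \<in> measurable M RC"
    using Suc k by (intro measurable_step measurable_xi) auto
  then show ?case
    using x_Suc[OF k] by (subst measurable_cong) auto
qed

lemma measurable_x: "k \<in> {1..Suc K} \<Longrightarrow> x k \<in> measurable M RC"
  using measurable_x_Suc[of "k - 1"] by (cases k) auto

lemma x_in: "k \<in> {1..Suc K} \<Longrightarrow> v \<in> space M \<Longrightarrow> x k v \<in> C"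
  using measurable_space[OF measurable_x] by (simp add: space_restrict_space)

lemma distr_x_xi':
  assumes k: "k \<in> {1..K}"
  shows "distr M (RC \<Otimes>\<^sub>M \<Xi>) (\<lambda>v. (x k v, \<xi>' k v)) = distr M RC (x k) \<Otimes>\<^sub>M \<Xi>"
proof -
  obtain j where j: "k = Suc j" "j < K"
    using k by (cases k) auto
  have "M.indep_var (PiM (past j) (\<lambda>_. \<Xi>)) (\<lambda>v. restrict (\<lambda>i. sample i v) (past j))
      (PiM {Inr k} (\<lambda>_. \<Xi>)) (\<lambda>v. restrict (\<lambda>i. sample i v) {Inr k})"
    using j by (intro M.indep_var_restrict[OF indep_samples]) auto
  from M.indep_var_distr_compose[OF this, of "history_iterate j" RC "\<lambda>h. h (Inr k)" \<Xi>]
  have "distr M RC (\<lambda>v. history_iterate j (restrict (\<lambda>i. sample i v) (past j))) \<Otimes>\<^sub>M distr M \<Xi> (\<xi>' k)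
      = distr M (RC \<Otimes>\<^sub>M \<Xi>) (\<lambda>v. (history_iterate j (restrict (\<lambda>i. sample i v) (past j)), \<xi>' k v))"
    using measurable_history_iterate[OF order_refl order_refl, of j]
    by (simp add: measurable_component_singleton)
  moreover have "distr M RC (\<lambda>v. history_iterate j (restrict (\<lambda>i. sample i v) (past j))) = distr M RC (x k)"
    using j x_history[of j j "past j"] by (intro distr_cong) auto
  moreover have "distr M (RC \<Otimes>\<^sub>M \<Xi>) (\<lambda>v. (history_iterate j (restrict (\<lambda>i. sample i v) (past j)), \<xi>' k v))
      = distr M (RC \<Otimes>\<^sub>M \<Xi>) (\<lambda>v. (x k v, \<xi>' k v))"
    using j x_history[of j j "past j"] by (intro distr_cong) auto
  ultimately show ?thesis
    using distr_xi(2)[OF k] by simp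
qed

text \<open>Independence is used twice: the model sample is split off from the past together with
  \<open>\<xi>' k\<close>, and within that block the past is split from
  \<open>\<xi>' k\<close>.\<close>

lemma distr_x_xi'_xi:
  assumes k: "k \<in> {1..K}"
  shows "distr M ((RC \<Otimes>\<^sub>M \<Xi>) \<Otimes>\<^sub>M \<Xi>) (\<lambda>v. ((x k v, \<xi>' k v), \<xi> k v)) = (distr M RC (x k) \<Otimes>\<^sub>M \<Xi>) \<Otimes>\<^sub>M \<Xi>"
proof -
  obtain j where j: "k = Suc j" "j < K"
    using k by (cases k) auto
  define A where "A = insert (Inr k) (past j)"
  define h where "h v = restrict (\<lambda>i. sample i v) A" for v
  have h: "history_iterate j (h v) = x k v" "h v (Inr k) = \<xi>' k v" if "v \<in> space M" for v
  proof -
    have "past j \<subseteq> A"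
      by (simp add: A_def subset_insertI)
    then show "history_iterate j (h v) = x k v"
      using j x_history[OF order_refl _ _ that, of j A] by (simp add: h_def)
    show "h v (Inr k) = \<xi>' k v"
      by (simp add: h_def A_def)
  qed
  have indep: "M.indep_var (PiM A (\<lambda>_. \<Xi>)) h (PiM {Inl k} (\<lambda>_. \<Xi>)) (\<lambda>v. restrict (\<lambda>i. sample i v) {Inl k})"
    unfolding h_def using j by (intro M.indep_var_restrict[OF indep_samples]) (auto simp: A_def)
  have meas: "(\<lambda>h. (history_iterate j h, h (Inr k))) \<in> measurable (PiM A (\<lambda>_. \<Xi>)) (RC \<Otimes>\<^sub>M \<Xi>)"
    by (intro measurable_Pair measurable_history_iterate[OF order_refl] measurable_component_singleton)
      (auto simp: A_def)
  have "(\<lambda>h. h (Inl k)) \<in> measurable (PiM {Inl k} (\<lambda>_. \<Xi>)) \<Xi>"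
    by (intro measurable_component_singleton) simp
  from M.indep_var_distr_compose[OF indep meas this]
  have "distr M (RC \<Otimes>\<^sub>M \<Xi>) (\<lambda>v. (history_iterate j (h v), h v (Inr k))) \<Otimes>\<^sub>M distr M \<Xi> (\<xi> k)
      = distr M ((RC \<Otimes>\<^sub>M \<Xi>) \<Otimes>\<^sub>M \<Xi>) (\<lambda>v. ((history_iterate j (h v), h v (Inr k)), \<xi> k v))"
    by simp
  moreover have "distr M (RC \<Otimes>\<^sub>M \<Xi>) (\<lambda>v. (history_iterate j (h v), h v (Inr k)))
      = distr M (RC \<Otimes>\<^sub>M \<Xi>) (\<lambda>v. (x k v, \<xi>' k v))"
    using h by (intro distr_cong) auto
  moreover have "distr M ((RC \<Otimes>\<^sub>M \<Xi>) \<Otimes>\<^sub>M \<Xi>) (\<lambda>v. ((history_iterate j (h v), h v (Inr k)), \<xi> k v))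
      = distr M ((RC \<Otimes>\<^sub>M \<Xi>) \<Otimes>\<^sub>M \<Xi>) (\<lambda>v. ((x k v, \<xi>' k v), \<xi> k v))"
    using h by (intro distr_cong) auto
  ultimately show ?thesis
    using distr_xi(1)[OF k] distr_x_xi'[OF k] by simp
qed

text \<open>Fubini in place of a conditional expectation: in the innermost integral the iterate and
  the step size are frozen, as \<open>env_step\<close> requires.\<close>

lemma nn_integral_x_xi'_xi:
  assumes k: "k \<in> {1..K}" and [measurable]: "\<Phi> \<in> borel_measurable ((RC \<Otimes>\<^sub>M \<Xi>) \<Otimes>\<^sub>M \<Xi>)"
  shows "(\<integral>\<^sup>+ v. \<Phi> ((x k v, \<xi>' k v), \<xi> k v) \<partial>M)
    = (\<integral>\<^sup>+ v. \<integral>\<^sup>+ s'. \<integral>\<^sup>+ s. \<Phi> ((x k v, s'), s) \<partial>\<Xi> \<partial>\<Xi> \<partial>M)"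
proof -
  note [measurable] = measurable_xi[OF k]
  have [measurable]: "x k \<in> measurable M RC"
    using measurable_x k by simp
  have "(\<integral>\<^sup>+ v. \<Phi> ((x k v, \<xi>' k v), \<xi> k v) \<partial>M)
      = (\<integral>\<^sup>+ z. \<Phi> z \<partial>distr M ((RC \<Otimes>\<^sub>M \<Xi>) \<Otimes>\<^sub>M \<Xi>) (\<lambda>v. ((x k v, \<xi>' k v), \<xi> k v)))"
    by (subst nn_integral_distr) auto
  also have "\<dots> = (\<integral>\<^sup>+ z. \<integral>\<^sup>+ s. \<Phi> (z, s) \<partial>\<Xi> \<partial>(distr M RC (x k) \<Otimes>\<^sub>M \<Xi>))"
    unfolding distr_x_xi'_xi[OF k]
    by (rule nn_integral_fst[symmetric]) (simp cong: measurable_cong_sets)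
  also have "\<dots> = (\<integral>\<^sup>+ y. \<integral>\<^sup>+ s'. \<integral>\<^sup>+ s. \<Phi> ((y, s'), s) \<partial>\<Xi> \<partial>\<Xi> \<partial>distr M RC (x k))"
    by (rule nn_integral_fst[symmetric])
      (auto intro!: borel_measurable_nn_integral simp: case_prod_beta cong: measurable_cong_sets)
  also have "\<dots> = (\<integral>\<^sup>+ v. \<integral>\<^sup>+ s'. \<integral>\<^sup>+ s. \<Phi> ((x k v, s'), s) \<partial>\<Xi> \<partial>\<Xi> \<partial>M)"
    by (rule nn_integral_distr) measurable
  finally show ?thesis .
qed

section \<open>Mean noise and mean decrease of the envelope\<close>

lemma noise_bound:
  assumes y: "y \<in> C"
  shows "(\<integral>\<^sup>+ s'. \<integral>\<^sup>+ s. ennreal ((\<alpha> + L + \<bar>Lip y s - Lip y s'\<bar>)\<^sup>2) \<partial>\<Xi> \<partial>\<Xi>) \<le> ennreal ((\<alpha> + \<sigma> + L)\<^sup>2)"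
proof -
  note [measurable] = measurable_Lip[OF y]
  have "(\<integral>\<^sup>+ z. ennreal ((\<alpha> + L + \<bar>Lip y (snd z) - Lip y (fst z)\<bar>)\<^sup>2) \<partial>(\<Xi> \<Otimes>\<^sub>M \<Xi>))
      \<le> ennreal ((\<alpha> + L + \<sigma>)\<^sup>2)"
  proof (rule nn_integral_power2_add_le)
    show "prob_space (\<Xi> \<Otimes>\<^sub>M \<Xi>)"
      by (intro prob_space_pair prob_space_axioms)
    have "(\<integral>\<^sup>+ z. ennreal (\<bar>Lip y (snd z) - Lip y (fst z)\<bar>\<^sup>2) \<partial>(\<Xi> \<Otimes>\<^sub>M \<Xi>))
        = (\<integral>\<^sup>+ s'. \<integral>\<^sup>+ s. ennreal (\<bar>Lip y s - Lip y s'\<bar>\<^sup>2) \<partial>\<Xi> \<partial>\<Xi>)"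
      by (subst nn_integral_fst[symmetric]) auto
    then show "(\<integral>\<^sup>+ z. ennreal (\<bar>Lip y (snd z) - Lip y (fst z)\<bar>\<^sup>2) \<partial>(\<Xi> \<Otimes>\<^sub>M \<Xi>)) \<le> ennreal (\<sigma>\<^sup>2)"
      using Lip_variance[OF y] by simp
  qed (use alpha L_nonneg constants in auto)
  moreover have "(\<integral>\<^sup>+ z. ennreal ((\<alpha> + L + \<bar>Lip y (snd z) - Lip y (fst z)\<bar>)\<^sup>2) \<partial>(\<Xi> \<Otimes>\<^sub>M \<Xi>))
      = (\<integral>\<^sup>+ s'. \<integral>\<^sup>+ s. ennreal ((\<alpha> + L + \<bar>Lip y s - Lip y s'\<bar>)\<^sup>2) \<partial>\<Xi> \<partial>\<Xi>)"
    by (subst nn_integral_fst[symmetric]) auto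
  ultimately show ?thesis
    by (simp add: ac_simps)
qed

definition decrease :: "'a \<Rightarrow> 's \<Rightarrow> real" where
  "decrease y s' = (\<rho> - \<tau> - \<kappa>) / (\<rho> * (stepsize \<alpha> (sqrt (real K)) y s' - \<kappa>)) * (norm (gradient env y))\<^sup>2"

lemma measurable_prox [measurable]: "prox \<in> borel_measurable borel"
  by (rule borel_measurable_continuous_onI[OF continuous_prox])

lemma measurable_env [measurable]: "env \<in> borel_measurable borel"
  by (rule borel_measurable_continuous_onI[OF continuous_env])

lemma measurable_gradient_env [measurable]: "gradient env \<in> borel_measurable borel"
  unfolding gradient_env[abs_def] by measurable

lemma measurable_RC: "X \<in> measurable N RC \<Longrightarrow> X \<in> measurable N borel"
  by (simp add: measurable_restrict_space2_iff)

lemma measurable_decrease [measurable (raw)]: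
  assumes [measurable]: "X \<in> measurable N RC" "Y \<in> measurable N \<Xi>"
  shows "(\<lambda>v. decrease (X v) (Y v)) \<in> borel_measurable N"
proof -
  note [measurable] = measurable_RC[OF assms(1)]
  show ?thesis
    unfolding decrease_def by measurable
qed

text \<open>\<open>env_step\<close> is integrated over the extra sample and then over the law of
  \<open>x k\<close>. The noise bound is the same at all points of \<open>C\<close>, so the
  resulting constant does not depend on \<open>k\<close>.\<close>

lemma env_recursion:
  assumes k: "k \<in> {1..K}" and m: "\<And>y. m \<le> env y"
  shows "(\<integral>\<^sup>+ v. ennreal (env (x (Suc k) v) - m) \<partial>M) + (\<integral>\<^sup>+ v. ennreal (decrease (x k v) (\<xi>' k v)) \<partial>M)
    \<le> (\<integral>\<^sup>+ v. ennreal (env (x k v) - m) \<partial>M) + ennreal (\<rho> / (2 * real K * \<alpha>\<^sup>2) * (\<alpha> + \<sigma> + L)\<^sup>2)"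
proof -
  note [measurable] = measurable_xi[OF k]
  have xk [measurable]: "x k \<in> measurable M RC"
    using measurable_x k by simp
  note [measurable] = measurable_RC[OF xk]
  have xSk: "x (Suc k) \<in> measurable M RC"
    using measurable_x k by simp
  note [measurable] = measurable_RC[OF xSk]
  define c where "c = \<rho> / (2 * real K * \<alpha>\<^sup>2)"
  have c: "0 \<le> c"
    using rho_pos by (simp add: c_def)
  define \<Phi> where "\<Phi> z = ennreal (env (step (fst (fst z)) (snd (fst z)) (snd z)) - m)
    + ennreal (decrease (fst (fst z)) (snd (fst z)))" for z
  have st: "(\<lambda>z. step (fst (fst z)) (snd (fst z)) (snd z)) \<in> measurable ((RC \<Otimes>\<^sub>M \<Xi>) \<Otimes>\<^sub>M \<Xi>) RC"
    by (intro measurable_step) auto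
  note [measurable] = measurable_RC[OF st]
  have \<Phi> [measurable]: "\<Phi> \<in> borel_measurable ((RC \<Otimes>\<^sub>M \<Xi>) \<Otimes>\<^sub>M \<Xi>)"
    unfolding \<Phi>_def by measurable
  have "(\<integral>\<^sup>+ v. ennreal (env (x (Suc k) v) - m) \<partial>M) + (\<integral>\<^sup>+ v. ennreal (decrease (x k v) (\<xi>' k v)) \<partial>M)
      = (\<integral>\<^sup>+ v. ennreal (env (x (Suc k) v) - m) + ennreal (decrease (x k v) (\<xi>' k v)) \<partial>M)"
    by (rule nn_integral_add[symmetric]) measurable
  also have "\<dots> = (\<integral>\<^sup>+ v. \<Phi> ((x k v, \<xi>' k v), \<xi> k v) \<partial>M)"
    using x_Suc[OF k] by (intro nn_integral_cong) (simp add: \<Phi>_def)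
  also have "\<dots> = (\<integral>\<^sup>+ v. \<integral>\<^sup>+ s'. \<integral>\<^sup>+ s. \<Phi> ((x k v, s'), s) \<partial>\<Xi> \<partial>\<Xi> \<partial>M)"
    by (rule nn_integral_x_xi'_xi[OF k \<Phi>])
  also have "\<dots> \<le> (\<integral>\<^sup>+ v. ennreal (env (x k v) - m) + ennreal (c * (\<alpha> + \<sigma> + L)\<^sup>2) \<partial>M)"
  proof (rule nn_integral_mono)
    fix v assume "v \<in> space M"
    then have y: "x k v \<in> C"
      using x_in k by simp
    define y where "y = x k v"
    note y = y[folded y_def]
    note [measurable] = measurable_Lip[OF y]
    define N where "N s' s = ennreal ((\<alpha> + L + \<bar>Lip y s - Lip y s'\<bar>)\<^sup>2)" for s' s
    have "(\<integral>\<^sup>+ s'. \<integral>\<^sup>+ s. \<Phi> ((y, s'), s) \<partial>\<Xi> \<partial>\<Xi>)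
        \<le> (\<integral>\<^sup>+ s'. ennreal (env y - m) + ennreal c * (\<integral>\<^sup>+ s. N s' s \<partial>\<Xi>) \<partial>\<Xi>)"
    proof (rule nn_integral_mono)
      fix s' assume s': "s' \<in> space \<Xi>"
      have "(\<lambda>s. step y s' s) \<in> measurable \<Xi> RC"
        using s' by (intro measurable_step measurable_const_C y) auto
      note [measurable] = measurable_RC[OF this]
      have "(\<integral>\<^sup>+ s. \<Phi> ((y, s'), s) \<partial>\<Xi>) = (\<integral>\<^sup>+ s. ennreal (env (step y s' s) - m) \<partial>\<Xi>) + ennreal (decrease y s')"
        unfolding \<Phi>_def by (simp add: nn_integral_add emeasure_space_1)
      also have "\<dots> \<le> ennreal (env y - m) + ennreal c * (\<integral>\<^sup>+ s. N s' s \<partial>\<Xi>)"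
        using env_step[OF y alpha sqrt_K m, of s'] by (simp add: decrease_def N_def c_def)
      finally show "(\<integral>\<^sup>+ s. \<Phi> ((y, s'), s) \<partial>\<Xi>) \<le> ennreal (env y - m) + ennreal c * (\<integral>\<^sup>+ s. N s' s \<partial>\<Xi>)" .
    qed
    also have "\<dots> = ennreal (env y - m) + ennreal c * (\<integral>\<^sup>+ s'. \<integral>\<^sup>+ s. N s' s \<partial>\<Xi> \<partial>\<Xi>)"
    proof -
      have [measurable]: "(\<lambda>s'. \<integral>\<^sup>+ s. N s' s \<partial>\<Xi>) \<in> borel_measurable \<Xi>"
        unfolding N_def by measurable
      show ?thesis
        by (simp add: nn_integral_add nn_integral_cmult emeasure_space_1)
    qed
    also have "\<dots> \<le> ennreal (env y - m) + ennreal c * ennreal ((\<alpha> + \<sigma> + L)\<^sup>2)"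
      unfolding N_def by (intro add_left_mono mult_left_mono noise_bound y) simp
    finally show "(\<integral>\<^sup>+ s'. \<integral>\<^sup>+ s. \<Phi> ((x k v, s'), s) \<partial>\<Xi> \<partial>\<Xi>)
        \<le> ennreal (env (x k v) - m) + ennreal (c * (\<alpha> + \<sigma> + L)\<^sup>2)"
      using c by (simp add: y_def ennreal_mult)
  qed
  also have "\<dots> = (\<integral>\<^sup>+ v. ennreal (env (x k v) - m) \<partial>M) + ennreal (c * (\<alpha> + \<sigma> + L)\<^sup>2)"
    by (simp add: nn_integral_add M.emeasure_space_1)
  finally show ?thesis
    by (simp add: c_def)
qed

lemma env_telescope:
  assumes m: "\<And>y. m \<le> env y" and n: "n \<le> K"
  shows "(\<integral>\<^sup>+ v. ennreal (env (x (Suc n) v) - m) \<partial>M)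
      + (\<Sum>k\<in>{1..n}. \<integral>\<^sup>+ v. ennreal (decrease (x k v) (\<xi>' k v)) \<partial>M)
    \<le> ennreal (env x1 - m) + ennreal (real n * (\<rho> / (2 * real K * \<alpha>\<^sup>2) * (\<alpha> + \<sigma> + L)\<^sup>2))"
  using n
proof (induction n)
  case 0
  have "(\<integral>\<^sup>+ v. ennreal (env (x 1 v) - m) \<partial>M) = (\<integral>\<^sup>+ v. ennreal (env x1 - m) \<partial>M)"
    using x_first by (intro nn_integral_cong) simp
  then show ?case
    by (simp add: M.emeasure_space_1)
next
  case (Suc n)
  define c where "c = \<rho> / (2 * real K * \<alpha>\<^sup>2) * (\<alpha> + \<sigma> + L)\<^sup>2"
  define a where "a k = (\<integral>\<^sup>+ v. ennreal (env (x k v) - m) \<partial>M)" for k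
  define d where "d k = (\<integral>\<^sup>+ v. ennreal (decrease (x k v) (\<xi>' k v)) \<partial>M)" for k
  have c: "0 \<le> c"
    using rho_pos by (simp add: c_def)
  have "a (Suc (Suc n)) + sum d {1..Suc n} = (a (Suc (Suc n)) + d (Suc n)) + sum d {1..n}"
    by (simp add: ac_simps)
  also have "\<dots> \<le> (a (Suc n) + ennreal c) + sum d {1..n}"
    using env_recursion[of "Suc n" m] m Suc.prems
    by (intro add_right_mono) (simp add: a_def c_def d_def)
  also have "\<dots> = (a (Suc n) + sum d {1..n}) + ennreal c"
    by (simp add: ac_simps)
  also have "\<dots> \<le> (ennreal (env x1 - m) + ennreal (real n * c)) + ennreal c"
    using Suc by (intro add_right_mono) (simp add: a_def c_def d_def)
  also have "\<dots> = ennreal (env x1 - m) + ennreal (real (Suc n) * c)"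
    using c by (simp add: add.assoc ennreal_plus[symmetric] algebra_simps del: ennreal_plus)
  finally show ?case
    by (simp add: a_def c_def d_def)
qed

text \<open>The mean noise accumulated over \<open>K\<close> steps. The factor 1/2 stems from
  completing the square in a single step.\<close>

definition budget :: real where
  "budget = \<rho> / (2 * \<alpha>\<^sup>2) * (\<alpha> + \<sigma> + L)\<^sup>2"

text \<open>The bound \<open>m\<close> stays free: -\<Lambda> is inserted for excursions from the
  ball and the infimum of \<psi> for the gradients.\<close>

lemma env_telescope_budget:
  assumes m: "\<And>y. m \<le> env y" and n: "n \<le> K"
  shows "(\<integral>\<^sup>+ v. ennreal (env (x (Suc n) v) - m) \<partial>M)
      + (\<Sum>k\<in>{1..n}. \<integral>\<^sup>+ v. ennreal (decrease (x k v) (\<xi>' k v)) \<partial>M)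
    \<le> ennreal (env x1 - m + budget)"
proof -
  have "real n * (\<rho> / (2 * real K * \<alpha>\<^sup>2) * (\<alpha> + \<sigma> + L)\<^sup>2)
      \<le> real K * (\<rho> / (2 * real K * \<alpha>\<^sup>2) * (\<alpha> + \<sigma> + L)\<^sup>2)"
    using n rho_pos by (intro mult_right_mono) auto
  also have "\<dots> = budget"
    using K by (simp add: budget_def)
  finally have "ennreal (env x1 - m) + ennreal (real n * (\<rho> / (2 * real K * \<alpha>\<^sup>2) * (\<alpha> + \<sigma> + L)\<^sup>2))
      \<le> ennreal (env x1 - m) + ennreal budget"
    by (intro add_left_mono ennreal_leI)
  also have "\<dots> = ennreal (env x1 - m + budget)"
    using m[of x1] rho_pos by (simp add: budget_def)
  finally show ?thesis
    using env_telescope[OF m n] by (rule order_trans[rotated])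
qed

lemma expectation_env:
  assumes m: "\<And>y. m \<le> env y" and k: "k \<in> {1..K}"
  shows "(\<integral>\<^sup>+ v. ennreal (env (x k v) - m) \<partial>M) \<le> ennreal (env x1 - m + budget)"
proof -
  obtain j where "k = Suc j" "j \<le> K"
    using k by (cases k) auto
  then show ?thesis
    using order_trans[OF add_increasing2[OF zero_le order_refl] env_telescope_budget[OF m, of j]] by simp
qed

lemma sum_expectation_decrease:
  assumes m: "\<And>y. m \<le> env y"
  shows "(\<Sum>k\<in>{1..K}. \<integral>\<^sup>+ v. ennreal (decrease (x k v) (\<xi>' k v)) \<partial>M) \<le> ennreal (env x1 - m + budget)"
  by (rule order_trans[OF add_increasing[OF zero_le order_refl] env_telescope_budget[OF m order_refl]])

end

section \<open>Excursions from the ball and gradients inside it\<close>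

context model_run begin

text \<open>Markov's inequality for the envelope shifted by \<Lambda>, which is nonnegative
  everywhere and still at least \<open>c\<close> outside the ball since \<Lambda> >= 0. The level
  \<open>c\<close> is later \<Delta> / \<delta>.\<close>

lemma prob_leave_ball:
  assumes k: "k \<in> {1..K}" and lower: "\<And>y. - \<Lambda> \<le> env y" and "0 \<le> \<Lambda>" "0 < c"
    and far: "\<And>y. y \<notin> cball 0 r \<Longrightarrow> c \<le> env y"
    and budget: "env x1 + \<Lambda> + budget \<le> \<delta> * c"
  shows "emeasure M {v \<in> space M. x k v \<notin> cball 0 r} \<le> ennreal \<delta>"
proof -
  have xk: "x k \<in> measurable M RC"
    using measurable_x k by simp
  note [measurable] = measurable_RC[OF xk]
  have "emeasure M {v \<in> space M. x k v \<notin> cball 0 r}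
      = (\<integral>\<^sup>+ v. indicator {v \<in> space M. x k v \<notin> cball 0 r} v \<partial>M)"
    by simp
  also have "\<dots> \<le> (\<integral>\<^sup>+ v. ennreal (1 / c) * ennreal (env (x k v) - (- \<Lambda>)) \<partial>M)"
  proof (rule nn_integral_mono)
    fix v
    show "indicator {v \<in> space M. x k v \<notin> cball 0 r} v \<le> ennreal (1 / c) * ennreal (env (x k v) - (- \<Lambda>))"
    proof (cases "v \<in> space M \<and> x k v \<notin> cball 0 r")
      case True
      then have "1 \<le> 1 / c * (env (x k v) - (- \<Lambda>))"
        using far[of "x k v"] \<open>0 \<le> \<Lambda>\<close> \<open>0 < c\<close> by (simp add: field_simps)
      then have "ennreal 1 \<le> ennreal (1 / c * (env (x k v) - (- \<Lambda>)))"
        by (rule ennreal_leI)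
      also have "\<dots> = ennreal (1 / c) * ennreal (env (x k v) - (- \<Lambda>))"
        using \<open>0 < c\<close> by (intro ennreal_mult') simp
      finally show ?thesis
        using True by simp
    qed auto
  qed
  also have "\<dots> = ennreal (1 / c) * (\<integral>\<^sup>+ v. ennreal (env (x k v) - (- \<Lambda>)) \<partial>M)"
    by (rule nn_integral_cmult) measurable
  also have "\<dots> \<le> ennreal (1 / c) * ennreal (env x1 - (- \<Lambda>) + budget)"
    using expectation_env[OF lower k] by (rule mult_left_mono) simp
  also have "\<dots> = ennreal (1 / c * (env x1 - (- \<Lambda>) + budget))"
    using \<open>0 < c\<close> by (intro ennreal_mult'[symmetric]) simp
  also have "\<dots> \<le> ennreal \<delta>"
    using budget \<open>0 < c\<close> by (intro ennreal_leI) (simp add: field_simps)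
  finally show ?thesis .
qed

lemma sets_in_ball: "k \<in> {1..K} \<Longrightarrow> {v \<in> space M. x k v \<in> cball 0 r} \<in> sets M"
  using measurable_sets[OF measurable_RC[OF measurable_x], of k "cball 0 r"]
  by (simp add: vimage_def Int_def conj_commute)

lemma sets_many_in_ball: "many_in_ball M x K r m \<in> sets M"
proof -
  have [measurable]: "(\<lambda>v. \<Sum>k\<in>{1..K}. indicator {v \<in> space M. x k v \<in> cball 0 r} v :: real) \<in> borel_measurable M"
    by (intro borel_measurable_sum borel_measurable_indicator sets_in_ball)
  have "many_in_ball M x K r m
      = {v \<in> space M. m \<le> (\<Sum>k\<in>{1..K}. indicator {v \<in> space M. x k v \<in> cball 0 r} v :: real)}"
    unfolding many_in_ball_def
    by (auto simp: indicator_def sum.If_cases Int_def)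
  also have "\<dots> \<in> sets M"
    by measurable
  finally show ?thesis .
qed

lemma sets_kth_in_ball:
  assumes "k \<in> {1..K}"
  shows "kth_in_ball M x K r m k \<in> sets M"
proof -
  have "kth_in_ball M x K r m k = many_in_ball M x K r m \<inter> {v \<in> space M. x k v \<in> cball 0 r}"
    by (auto simp: kth_in_ball_def many_in_ball_def)
  then show ?thesis
    using sets_many_in_ball sets_in_ball[OF assms] by auto
qed

text \<open>The mean number of excursions is at most K \<delta>, so more than 2 \<delta> K / p of
  them occur with probability at most p/2. The other half of p is kept for the event that one given
  iterate is outside, since \<delta> < p/2.\<close>

lemma prob_many_in_ball:
  assumes leave: "\<And>k. k \<in> {1..K} \<Longrightarrow> emeasure M {v \<in> space M. x k v \<notin> cball 0 r} \<le> ennreal \<delta>"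
    and \<delta>: "0 < \<delta>" and p: "0 < p"
  shows "1 - p / 2 \<le> M.prob (many_in_ball M x K r ((1 - 2 * \<delta> / p) * real K))"
proof -
  define A where "A = many_in_ball M x K r ((1 - 2 * \<delta> / p) * real K)"
  define out where "out k = {v \<in> space M. x k v \<notin> cball 0 r}" for k
  have [measurable]: "A \<in> sets M"
    by (simp add: A_def sets_many_in_ball)
  have out [measurable]: "out k \<in> sets M" if "k \<in> {1..K}" for k
  proof -
    have "out k = space M - {v \<in> space M. x k v \<in> cball 0 r}"
      by (auto simp: out_def)
    then show ?thesis
      using sets_in_ball[OF that, of r] by simp
  qed
  define c where "c = p / (2 * \<delta> * real K)"
  have c: "0 < c"
    using \<delta> p K by (simp add: c_def)
  have "emeasure M (space M - A) = (\<integral>\<^sup>+ v. indicator (space M - A) v \<partial>M)"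
    by simp
  also have "\<dots> \<le> (\<integral>\<^sup>+ v. ennreal c * (\<Sum>k\<in>{1..K}. indicator (out k) v) \<partial>M)"
  proof (rule nn_integral_mono)
    fix v
    show "indicator (space M - A) v \<le> ennreal c * (\<Sum>k\<in>{1..K}. indicator (out k) v)"
    proof (cases "v \<in> space M - A")
      case True
      define I where "I = {k \<in> {1..K}. x k v \<in> cball 0 r}"
      define O' where "O' = {k \<in> {1..K}. x k v \<notin> cball 0 r}"
      have "{1..K} = I \<union> O'" "I \<inter> O' = {}" "finite I" "finite O'"
        by (auto simp: I_def O'_def)
      then have "card {1..K} = card I + card O'"
        using card_Un_disjoint[of I O'] by simp
      then have "real K = real (card I) + real (card O')"
        by simp
      moreover have "real (card I) < (1 - 2 * \<delta> / p) * real K"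
        using True by (auto simp: A_def many_in_ball_def I_def)
      ultimately have "2 * \<delta> / p * real K \<le> real (card O')"
        by (simp add: algebra_simps)
      then have "1 \<le> c * real (card O')"
        using \<delta> p K by (simp add: c_def field_simps)
      also have "real (card O') = (\<Sum>k\<in>{1..K}. indicator (out k) v :: real)"
        using True by (simp add: O'_def out_def indicator_def sum.If_cases Int_def)
      finally have "ennreal 1 \<le> ennreal (c * (\<Sum>k\<in>{1..K}. indicator (out k) v))"
        by (rule ennreal_leI)
      also have "\<dots> = ennreal c * (\<Sum>k\<in>{1..K}. indicator (out k) v)"
        using c by (simp add: ennreal_mult' sum_ennreal[symmetric] ennreal_indicator)
      finally show ?thesis
        using True by simp
    qed simp
  qed
  also have "\<dots> = ennreal c * (\<integral>\<^sup>+ v. (\<Sum>k\<in>{1..K}. indicator (out k) v) \<partial>M)"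
    by (intro nn_integral_cmult borel_measurable_sum borel_measurable_indicator out)
  also have "(\<integral>\<^sup>+ v. (\<Sum>k\<in>{1..K}. indicator (out k) v) \<partial>M)
      = (\<Sum>k\<in>{1..K}. \<integral>\<^sup>+ v. indicator (out k) v \<partial>M)"
    by (intro nn_integral_sum borel_measurable_indicator out)
  also have "\<dots> = (\<Sum>k\<in>{1..K}. emeasure M (out k))"
    by (intro sum.cong refl nn_integral_indicator out)
  also have "ennreal c * (\<Sum>k\<in>{1..K}. emeasure M (out k)) \<le> ennreal c * (\<Sum>k\<in>{1..K}. ennreal \<delta>)"
    using leave by (intro mult_left_mono sum_mono) (auto simp: out_def)
  also have "\<dots> = ennreal (c * (real K * \<delta>))"
    using c \<delta> by (simp add: ennreal_mult ennreal_of_nat_eq_real_of_nat)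
  also have "c * (real K * \<delta>) = p / 2"
    using \<delta> K by (simp add: c_def)
  finally have "M.prob (space M - A) \<le> p / 2"
    using p by (simp add: M.emeasure_eq_measure)
  then show ?thesis
    using M.prob_compl[of A] by (simp add: A_def[symmetric])
qed

lemma prob_kth_in_ball:
  assumes leave: "\<And>k. k \<in> {1..K} \<Longrightarrow> emeasure M {v \<in> space M. x k v \<notin> cball 0 r} \<le> ennreal \<delta>"
    and \<delta>: "0 < \<delta>" and p: "0 < p" and k: "k \<in> {1..K}"
  shows "1 - p / 2 - \<delta> \<le> M.prob (kth_in_ball M x K r ((1 - 2 * \<delta> / p) * real K) k)"
proof -
  define A where "A = many_in_ball M x K r ((1 - 2 * \<delta> / p) * real K)"
  define B where "B = {v \<in> space M. x k v \<notin> cball 0 r}"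
  have sets: "A \<in> sets M" "kth_in_ball M x K r ((1 - 2 * \<delta> / p) * real K) k \<in> sets M"
    using sets_many_in_ball sets_kth_in_ball[OF k] by (auto simp: A_def)
  have "B = space M - {v \<in> space M. x k v \<in> cball 0 r}"
    by (auto simp: B_def)
  then have B: "B \<in> sets M"
    using sets_in_ball[OF k, of r] by simp
  have "A \<subseteq> kth_in_ball M x K r ((1 - 2 * \<delta> / p) * real K) k \<union> B"
    by (auto simp: A_def B_def kth_in_ball_def many_in_ball_def)
  then have "M.prob A \<le> M.prob (kth_in_ball M x K r ((1 - 2 * \<delta> / p) * real K) k \<union> B)"
    using sets B by (intro M.finite_measure_mono) auto
  also have "\<dots> \<le> M.prob (kth_in_ball M x K r ((1 - 2 * \<delta> / p) * real K) k) + M.prob B"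
    using sets B by (intro measure_Un_le) auto
  also have "M.prob B \<le> \<delta>"
    using leave[OF k] \<delta> by (simp add: B_def M.emeasure_eq_measure)
  finally show ?thesis
    using prob_many_in_ball[OF leave \<delta> p] by (simp add: A_def)
qed

text \<open>The events may vary with \<open>k\<close>, since each conditional mean is compared
  separately with an unconditional one: restricting to \<open>A k\<close> bounds the step size, and
  dropping the restriction afterwards only enlarges the nonnegative decrease. The total decrease is
  bounded, and the minimum is at most the average.\<close>

lemma min_gradient_bound:
  assumes m: "\<And>y. m \<le> env y" and c: "0 < c"
    and A: "\<And>k. k \<in> {1..K} \<Longrightarrow> A k \<in> sets M" "\<And>k. k \<in> {1..K} \<Longrightarrow> c \<le> M.prob (A k)"
    and ball: "\<And>k v. k \<in> {1..K} \<Longrightarrow> v \<in> A k \<Longrightarrow> x k v \<in> cball 0 r"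
    and G: "0 \<le> G" "\<And>y s. y \<in> C \<inter> cball 0 r \<Longrightarrow> s \<in> space \<Xi> \<Longrightarrow> Lip y s \<le> G"
  shows "(MIN k\<in>{1..K}. expectation_given M (A k) (\<lambda>v. (norm (gradient env (x k v)))\<^sup>2))
    \<le> ennreal (1 / c * (\<rho> / (\<rho> - \<tau> - \<kappa>)) * (env x1 - m + budget)
        * ((\<rho> + \<tau> + \<kappa>) / real K + (\<alpha> + G) / sqrt (real K)))"
    (is "?min \<le> _")
proof -
  define E where "E k = expectation_given M (A k) (\<lambda>v. (norm (gradient env (x k v)))\<^sup>2)" for k
  \<comment> \<open>On \<open>A k\<close> the squared gradient is \<rho> (g - \<kappa>) / (\<rho> -
    \<tau> - \<kappa>) times the decrease, and \<open>b\<close> bounds this factor by estimating the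
    maximum of \<open>Lip\<close> and \<alpha> by \<alpha> + G.\<close>
  define b where "b = \<rho> / (\<rho> - \<tau> - \<kappa>) * (\<rho> + \<tau> + \<kappa> + (\<alpha> + G) * sqrt (real K))"
  have pos: "0 < \<rho> - \<tau> - \<kappa>" "0 < \<rho> + \<tau> + \<kappa>"
    using constants by auto
  have b: "0 < b"
    unfolding b_def using pos rho_pos G(1) alpha constants by (intro mult_pos_pos divide_pos_pos add_pos_nonneg) auto
  have E: "E k \<le> ennreal (1 / c * b) * (\<integral>\<^sup>+ v. ennreal (decrease (x k v) (\<xi>' k v)) \<partial>M)"
    if k: "k \<in> {1..K}" for k
  proof -
    note [measurable] = measurable_xi[OF k] A(1)[OF k]
    have xk [measurable]: "x k \<in> measurable M RC"
      using measurable_x k by simp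
    note [measurable] = measurable_RC[OF xk]
    have pk: "0 < M.prob (A k)"
      using c A(2)[OF k] by simp
    have pointwise: "ennreal ((norm (gradient env (x k v)))\<^sup>2) * indicator (A k) v
        \<le> ennreal b * ennreal (decrease (x k v) (\<xi>' k v))" if v: "v \<in> space M" for v
    proof (cases "v \<in> A k")
      case True
      define g where "g = stepsize \<alpha> (sqrt (real K)) (x k v) (\<xi>' k v)"
      define n where "n = (norm (gradient env (x k v)))\<^sup>2"
      have n: "0 \<le> n"
        by (simp add: n_def)
      have "Lip (x k v) (\<xi>' k v) \<le> G"
        using x_in[of k v] ball[OF k True] k v measurable_space[OF measurable_xi(2)[OF k] v]
        by (intro G(2)) auto
      then have "max (Lip (x k v) (\<xi>' k v)) \<alpha> * sqrt (real K) \<le> (\<alpha> + G) * sqrt (real K)"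
        using G(1) alpha by (intro mult_right_mono) auto
      then have g: "g - \<kappa> \<le> \<rho> + \<tau> + \<kappa> + (\<alpha> + G) * sqrt (real K)" "0 < g - \<kappa>"
        using constants stepsize_gt[OF alpha sqrt_K, of "x k v" "\<xi>' k v"]
        by (auto simp: g_def stepsize_def)
      have "n = \<rho> / (\<rho> - \<tau> - \<kappa>) * (g - \<kappa>) * ((\<rho> - \<tau> - \<kappa>) / (\<rho> * (g - \<kappa>)) * n)"
        using pos g rho_pos by simp
      also have "\<dots> \<le> b * ((\<rho> - \<tau> - \<kappa>) / (\<rho> * (g - \<kappa>)) * n)"
        unfolding b_def using pos g rho_pos n by (intro mult_right_mono mult_left_mono) auto
      finally have "ennreal n \<le> ennreal (b * decrease (x k v) (\<xi>' k v))"
        by (intro ennreal_leI) (simp add: decrease_def g_def n_def)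
      also have "\<dots> = ennreal b * ennreal (decrease (x k v) (\<xi>' k v))"
        using b by (intro ennreal_mult') simp
      finally show ?thesis
        using True by (simp add: n_def)
    qed simp
    have "E k = (\<integral>\<^sup>+ v. ennreal ((norm (gradient env (x k v)))\<^sup>2) * indicator (A k) v \<partial>M) / emeasure M (A k)"
      unfolding E_def expectation_given_def by (rule nn_integral_uniform_measure) measurable
    also have "\<dots> = (\<integral>\<^sup>+ v. ennreal ((norm (gradient env (x k v)))\<^sup>2) * indicator (A k) v \<partial>M)
        * ennreal (1 / M.prob (A k))"
      using pk by (simp add: divide_ennreal_def M.emeasure_eq_measure inverse_ennreal inverse_eq_divide)
    also have "\<dots> \<le> (\<integral>\<^sup>+ v. ennreal b * ennreal (decrease (x k v) (\<xi>' k v)) \<partial>M) * ennreal (1 / c)"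
    proof (rule mult_mono)
      show "(\<integral>\<^sup>+ v. ennreal ((norm (gradient env (x k v)))\<^sup>2) * indicator (A k) v \<partial>M)
          \<le> (\<integral>\<^sup>+ v. ennreal b * ennreal (decrease (x k v) (\<xi>' k v)) \<partial>M)"
        by (rule nn_integral_mono) (rule pointwise)
      show "ennreal (1 / M.prob (A k)) \<le> ennreal (1 / c)"
        using c A(2)[OF k] by (intro ennreal_leI divide_left_mono) auto
    qed auto
    also have "(\<integral>\<^sup>+ v. ennreal b * ennreal (decrease (x k v) (\<xi>' k v)) \<partial>M)
        = ennreal b * (\<integral>\<^sup>+ v. ennreal (decrease (x k v) (\<xi>' k v)) \<partial>M)"
      by (rule nn_integral_cmult) measurable
    also have "ennreal b * (\<integral>\<^sup>+ v. ennreal (decrease (x k v) (\<xi>' k v)) \<partial>M) * ennreal (1 / c)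
        = ennreal (1 / c * b) * (\<integral>\<^sup>+ v. ennreal (decrease (x k v) (\<xi>' k v)) \<partial>M)"
    proof -
      have "ennreal (1 / c * b) = ennreal (1 / c) * ennreal b"
        using b c by (intro ennreal_mult) auto
      then show ?thesis
        by (simp only: ac_simps)
    qed
    finally show ?thesis .
  qed
  have "ennreal (real K) * ?min = (\<Sum>k\<in>{1..K}. ?min)"
    by (simp add: ennreal_of_nat_eq_real_of_nat)
  also have "\<dots> \<le> (\<Sum>k\<in>{1..K}. ennreal (1 / c * b) * (\<integral>\<^sup>+ v. ennreal (decrease (x k v) (\<xi>' k v)) \<partial>M))"
  proof (rule sum_mono)
    fix k assume k: "k \<in> {1..K}"
    then have "?min \<le> E k"
      unfolding E_def by (intro Min_le) auto
    then show "?min \<le> ennreal (1 / c * b) * (\<integral>\<^sup>+ v. ennreal (decrease (x k v) (\<xi>' k v)) \<partial>M)"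
      using E[OF k] by (rule order_trans)
  qed
  also have "\<dots> \<le> ennreal (1 / c * b) * ennreal (env x1 - m + budget)"
    unfolding sum_distrib_left[symmetric] by (intro mult_left_mono sum_expectation_decrease m) simp
  also have "\<dots> = ennreal (1 / c * b * (env x1 - m + budget))"
    using b c by (intro ennreal_mult'[symmetric]) auto
  finally have "ennreal (1 / real K) * (ennreal (real K) * ?min)
      \<le> ennreal (1 / real K) * ennreal (1 / c * b * (env x1 - m + budget))"
    by (intro mult_left_mono) auto
  also have "ennreal (1 / real K) * (ennreal (real K) * ?min) = ?min"
    using K by (simp add: mult.assoc[symmetric] ennreal_mult[symmetric])
  also have "ennreal (1 / real K) * ennreal (1 / c * b * (env x1 - m + budget))
      = ennreal (1 / c * (\<rho> / (\<rho> - \<tau> - \<kappa>)) * (env x1 - m + budget)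
        * ((\<rho> + \<tau> + \<kappa>) / real K + (\<alpha> + G) / sqrt (real K)))"
  proof -
    have "(\<alpha> + G) / sqrt (real K) = (\<alpha> + G) * sqrt (real K) / real K"
      using K by (simp add: real_div_sqrt field_simps)
    then have "(\<rho> + \<tau> + \<kappa>) / real K + (\<alpha> + G) / sqrt (real K)
        = (\<rho> + \<tau> + \<kappa> + (\<alpha> + G) * sqrt (real K)) / real K"
      by (simp add: add_divide_distrib)
    then show ?thesis
      using K by (simp add: b_def ennreal_mult'[symmetric] mult_ac)
  qed
  finally show ?thesis .
qed

end

text \<open>At a limit point outside the domain, lower semicontinuity forces the values along the
  sequence to infinity, whereas Lipschitz continuity on the domain keeps them bounded along a
  bounded sequence.\<close>

lemma closed_edom:
  fixes \<omega> :: "'a::euclidean_space \<Rightarrow> ereal"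
  assumes lsc: "lower_semicontinuous \<omega>" and proper: "\<And>y. \<omega> y \<noteq> -\<infinity>"
    and lip: "L-lipschitz_on (edom \<omega>) (\<lambda>y. real_of_ereal (\<omega> y))"
  shows "closed (edom \<omega>)"
  unfolding closed_sequential_limits
proof (intro allI impI)
  fix u l assume *: "(\<forall>n. u n \<in> edom \<omega>) \<and> u \<longlonglongrightarrow> l"
  then have u: "u n \<in> edom \<omega>" for n
    by blast
  have fin: "\<omega> y = ereal (real_of_ereal (\<omega> y))" if "y \<in> edom \<omega>" for y
    using that proper[of y] by (cases "\<omega> y") (auto simp: edom_def)
  show "l \<in> edom \<omega>"
  proof (rule ccontr)
    assume l: "l \<notin> edom \<omega>"
    have "bounded (range u)"
      using * by (auto intro: convergent_imp_bounded)
    then obtain b where b: "\<And>n. dist (u n) (u 0) \<le> b"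
      by (metis bounded_any_center rangeI dist_commute)
    define c where "c = real_of_ereal (\<omega> (u 0)) + L * b"
    have le: "\<omega> (u n) \<le> ereal c" for n
    proof -
      have "real_of_ereal (\<omega> (u n)) - real_of_ereal (\<omega> (u 0)) \<le> L * dist (u n) (u 0)"
        using lipschitz_onD[OF lip u u, of n 0] by (simp add: dist_real_def)
      also have "\<dots> \<le> L * b"
        using b lipschitz_on_nonneg[OF lip] by (intro mult_left_mono) auto
      finally have "ereal (real_of_ereal (\<omega> (u n))) \<le> ereal c"
        by (simp add: c_def)
      then show ?thesis
        using fin[OF u[of n]] by simp
    qed
    have "\<forall>\<^sub>F n in sequentially. ereal c < \<omega> (u n)"
    proof -
      have "\<omega> l = \<infinity>"
        using l by (simp add: edom_def)
      then have "\<infinity> \<le> Liminf (at l) \<omega>"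
        using lsc unfolding lower_semicontinuous_def by metis
      then have "ereal c < Liminf (at l) \<omega>"
        by simp
      then have "\<forall>\<^sub>F y in at l. ereal c < \<omega> y"
        by (rule less_LiminfD)
      \<comment> \<open>The filter \<open>at l\<close> excludes \<open>l\<close>; the sequence
        avoids it because \<open>l\<close> is outside the domain.\<close>
      moreover have "u n \<noteq> l" for n
        using u[of n] l by blast
      then have "filterlim u (at l) sequentially"
        using * by (simp add: filterlim_at)
      ultimately show ?thesis
        unfolding filterlim_iff by blast
    qed
    then have "\<exists>n. ereal c < \<omega> (u n)"
      by (rule eventually_happens'[rotated]) simp
    then show False
      using le leD by blast
  qed
qed

text \<open>Convexity of the domain comes out of the same inequality: a finite right side forces a
  finite value at the convex combination.\<close>

lemma strongly_convex_on_edom: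
  assumes wc: "weakly_convex \<kappa> \<omega>" and proper: "\<And>y. \<omega> y \<noteq> -\<infinity>"
  shows "strongly_convex_on (edom \<omega>) (- \<kappa>) (\<lambda>y. real_of_ereal (\<omega> y))"
proof (rule convex_on_imp_strongly_convex_on)
  define w where "w y = real_of_ereal (\<omega> y)" for y
  have fin: "\<omega> y = ereal (w y)" if "y \<in> edom \<omega>" for y
    using that proper[of y] by (cases "\<omega> y") (auto simp: edom_def w_def)
  have conv: "(1 - t) *\<^sub>R x + t *\<^sub>R y \<in> edom \<omega> \<and>
      w ((1 - t) *\<^sub>R x + t *\<^sub>R y) + \<kappa> / 2 * (norm ((1 - t) *\<^sub>R x + t *\<^sub>R y))\<^sup>2
        \<le> (1 - t) * (w x + \<kappa> / 2 * (norm x)\<^sup>2) + t * (w y + \<kappa> / 2 * (norm y)\<^sup>2)"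
    if t: "0 < t" "t < 1" and xy: "x \<in> edom \<omega>" "y \<in> edom \<omega>" for t x y
  proof -
    define z where "z = (1 - t) *\<^sub>R x + t *\<^sub>R y"
    have le: "\<omega> z + ereal (\<kappa> / 2 * (norm z)\<^sup>2)
        \<le> ereal ((1 - t) * (w x + \<kappa> / 2 * (norm x)\<^sup>2) + t * (w y + \<kappa> / 2 * (norm y)\<^sup>2))"
    proof -
      have "\<omega> z + ereal (\<kappa> / 2 * (norm z)\<^sup>2) \<le> ereal (1 - t) * (\<omega> x + ereal (\<kappa> / 2 * (norm x)\<^sup>2))
          + ereal t * (\<omega> y + ereal (\<kappa> / 2 * (norm y)\<^sup>2))"
        using wc t unfolding weakly_convex_def econvex_def z_def by blast
      then show ?thesis
        by (simp add: fin[OF xy(1)] fin[OF xy(2)])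
    qed
    then have z: "z \<in> edom \<omega>"
      unfolding edom_def by (cases "\<omega> z") auto
    then show ?thesis
      using le fin[OF z] by (simp add: z_def)
  qed
  have cvx: "convex (edom \<omega>)"
    unfolding convex_alt
  proof (intro ballI allI impI)
    fix x y and t :: real
    assume "x \<in> edom \<omega>" "y \<in> edom \<omega>" "0 \<le> t \<and> t \<le> 1"
    then show "(1 - t) *\<^sub>R x + t *\<^sub>R y \<in> edom \<omega>"
      using conv[of t x y] by (cases "t = 0 \<or> t = 1") auto
  qed
  show "convex_on (edom \<omega>) (\<lambda>y. real_of_ereal (\<omega> y) - - \<kappa> / 2 * (norm y)\<^sup>2)"
    using conv by (intro convex_onI cvx) (auto simp: w_def)
qed

theorem theorem5p2:
  fixes M :: "'w measure" and \<Xi> :: "'s measure"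
    and F :: "real ^ 'n \<Rightarrow> 's \<Rightarrow> real"
    and f :: "real ^ 'n \<Rightarrow> real"
    and \<omega> \<psi> :: "real ^ 'n \<Rightarrow> ereal"
    and fm :: "real ^ 'n \<Rightarrow> real ^ 'n \<Rightarrow> 's \<Rightarrow> real"
    and Lip :: "real ^ 'n \<Rightarrow> 's \<Rightarrow> real"
    and B :: "real \<Rightarrow> real"
    and \<kappa> \<tau> \<sigma> L\<^sub>\<omega> \<Lambda> \<rho> \<alpha> \<delta> p \<Delta> D R :: real
    and G :: ennreal
    and K :: nat
    and \<xi> \<xi>' :: "nat \<Rightarrow> 'w \<Rightarrow> 's"
    and x1 :: "real ^ 'n"
    and x :: "nat \<Rightarrow> 'w \<Rightarrow> real ^ 'n"
    and \<gamma> :: "nat \<Rightarrow> 'w \<Rightarrow> real"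
  assumes samples: "iid_samples M \<Xi> K \<xi> \<xi>'"
    and F_integrable: "\<And>y. integrable \<Xi> (F y)"
    and F_continuous: "\<And>s. s \<in> space \<Xi> \<Longrightarrow> continuous_on UNIV (\<lambda>y. F y s)"
    and F_weakly_convex: "\<And>s. s \<in> space \<Xi> \<Longrightarrow> \<exists>l. weakly_convex l (\<lambda>y. ereal (F y s))"
    and f_def: "f = (\<lambda>y. \<integral>s. F y s \<partial>\<Xi>)"
    and omega_proper: "\<And>y. \<omega> y \<noteq> -\<infinity>"
    and omega_lsc: "lower_semicontinuous \<omega>"
    and omega_weakly_convex: "weakly_convex \<kappa> \<omega>"
    and omega_lipschitz: "L\<^sub>\<omega>-lipschitz_on (edom \<omega>) (\<lambda>y. real_of_ereal (\<omega> y))"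
    and psi_def: "\<psi> = (\<lambda>y. ereal (f y) + \<omega> y)"
    and model_measurable: "measurable_model \<Xi> (edom \<omega>) fm Lip"
    and tau_nonneg: "0 \<le> \<tau>"
    and model: "model_condition \<Xi> (edom \<omega>) f \<tau> fm"
    and sigma_nonneg: "0 \<le> \<sigma>"
    and reference: "reference_lipschitz \<Xi> (edom \<omega>) fm Lip \<sigma>"
    and rho: "\<rho> > \<kappa> + \<tau>"
    and Lambda_nonneg: "0 \<le> \<Lambda>"
    and envelope_bounded: "\<And>y. ereal (- \<Lambda>) \<le> moreau_env \<rho> \<psi> y"
    and level_sets: "level_set_bound (moreau_env \<rho> \<psi>) B"
    and alpha: "\<alpha> > 0"
    and K: "1 \<le> K"
    and x1: "x1 \<in> edom \<omega>"
    and gamma_def: "\<gamma> = (\<lambda>k w. \<rho> + \<tau> + \<kappa> + max (Lip (x k w) (\<xi>' k w)) \<alpha> * sqrt (real K))"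
    and algorithm: "model_based_run M fm \<omega> x1 K \<xi> \<gamma> x"
    and Delta_def: "\<Delta> = real_of_ereal (moreau_env \<rho> \<psi> x1) + \<Lambda> + \<rho> / \<alpha>\<^sup>2 * (\<alpha> + \<sigma> + L\<^sub>\<omega>)\<^sup>2"
    and D_def: "D = real_of_ereal (\<psi> x1) - real_of_ereal (INF y. \<psi> y)"
    and delta: "0 < \<delta>" "\<delta> < 1 / 4"
    and p: "2 * \<delta> < p" "p < 1"
    and R_def: "R = B (\<Delta> / \<delta>) + 4 * (\<alpha> + \<sigma> + L\<^sub>\<omega>) / (\<alpha> * sqrt (real K))"
    and G_def: "G = lip_sup \<Xi> (edom \<omega>) Lip R"
  shows "measure M (many_in_ball M x K R ((1 - 2 * \<delta> / p) * real K)) \<ge> 1 - p \<and>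
     (\<forall>k\<in>{1..K}. measure M (kth_in_ball M x K R ((1 - 2 * \<delta> / p) * real K) k) \<ge> 1 - p) \<and>
     (MIN k\<in>{1..K}. expectation_given M (kth_in_ball M x K R ((1 - 2 * \<delta> / p) * real K) k)
          (\<lambda>w. (norm (gradient (\<lambda>y. real_of_ereal (moreau_env \<rho> \<psi> y)) (x k w)))\<^sup>2))
       \<le> ennreal (p / (p - 2 * \<delta>) * (2 * \<rho> / (\<rho> - \<tau> - \<kappa>)) * (D + \<rho> / \<alpha>\<^sup>2 * (\<alpha> + \<sigma> + L\<^sub>\<omega>)\<^sup>2))
         * (ennreal ((\<rho> + \<tau> + \<kappa>) / real K) + (ennreal \<alpha> + G) / ennreal (sqrt (real K)))"
proof -
  define C where "C = edom \<omega>"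
  define w where "w y = real_of_ereal (\<omega> y)" for y
  have fin: "\<omega> y = ereal (w y)" if "y \<in> C" for y
    using that omega_proper[of y] by (cases "\<omega> y") (auto simp: C_def edom_def w_def)
  have inf: "\<omega> y = \<infinity>" if "y \<notin> C" for y
    using that by (simp add: C_def edom_def)
  have psi_C: "\<psi> y = ereal (f y + w y)" if "y \<in> C" for y
    using fin[OF that] by (simp add: psi_def)
  have env_le_psi: "moreau_env \<rho> \<psi> y \<le> \<psi> y" for y
    unfolding moreau_env_def by (rule INF_lower2[of y]) auto
  have psi_lower: "ereal (- \<Lambda>) \<le> \<psi> y" for y
    using envelope_bounded env_le_psi by (rule order_trans)
  have x1C: "x1 \<in> C"
    using x1 by (simp add: C_def)
  interpret Xi: prob_space \<Xi>
    using samples by (simp add: iid_samples_def)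
  interpret M: prob_space M
    using samples by (simp add: iid_samples_def)
  interpret S: stochastic_model \<Xi> C w f fm Lip \<kappa> \<tau> \<sigma> L\<^sub>\<omega> \<rho>
  proof unfold_locales
    show "closed C"
      unfolding C_def by (rule closed_edom[OF omega_lsc omega_proper omega_lipschitz])
    show "C \<noteq> {}"
      using x1C by blast
    show "strongly_convex_on C (- \<kappa>) w"
      unfolding C_def w_def by (rule strongly_convex_on_edom[OF omega_weakly_convex omega_proper])
    show "L\<^sub>\<omega>-lipschitz_on C w"
      using omega_lipschitz unfolding C_def w_def .
    show "0 \<le> \<kappa>"
      using omega_weakly_convex by (simp add: weakly_convex_def)
    show "\<exists>m. \<forall>z\<in>C. m \<le> f z + w z"
      using psi_lower psi_C by (metis ereal_less_eq(3))
  qed (use tau_nonneg sigma_nonneg rho model_measurable model reference in \<open>auto simp: C_def\<close>)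
  have env: "moreau_env \<rho> \<psi> y = ereal (S.env y)" for y
    unfolding moreau_env_def
  proof (rule antisym)
    show "(INF z. \<psi> z + ereal (\<rho> / 2 * (norm (z - y))\<^sup>2)) \<le> ereal (S.env y)"
      by (rule INF_lower2[of "S.prox y"]) (simp_all add: psi_C[OF S.prox_in] S.env_def)
    show "ereal (S.env y) \<le> (INF z. \<psi> z + ereal (\<rho> / 2 * (norm (z - y))\<^sup>2))"
    proof (rule INF_greatest)
      fix z
      show "ereal (S.env y) \<le> \<psi> z + ereal (\<rho> / 2 * (norm (z - y))\<^sup>2)"
      proof (cases "z \<in> C")
        case True
        then show ?thesis
          using S.env_le[OF True, of y] by (simp add: psi_C)
      next
        case False
        then show ?thesis
          by (simp add: psi_def inf)
      qed
    qed
  qed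
  have iterate: "x k v \<in> C \<Longrightarrow> x (Suc k) v = S.model_prox (x k v) (\<gamma> k v) (\<xi> k v) \<and> x (Suc k) v \<in> C"
    if k: "k \<in> {1..K}" and v: "v \<in> space M" for k v
  proof -
    assume xC: "x k v \<in> C"
    define \<phi> where "\<phi> y = ereal (fm (x k v) y (\<xi> k v)) + \<omega> y + ereal (\<gamma> k v / 2 * (norm (y - x k v))\<^sup>2)" for y
    have min: "\<phi> (x (Suc k) v) \<le> \<phi> z" for z
      using algorithm k v unfolding model_based_run_def is_arg_min_def \<phi>_def by (meson not_le)
    have s: "\<xi> k v \<in> space \<Xi>"
    proof -
      have "Inl k \<in> {1..K} <+> {1..K}"
        using k by blast
      then have "case_sum \<xi> \<xi>' (Inl k) \<in> measurable M \<Xi>"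
        using samples unfolding iid_samples_def M.indep_vars_def by blast
      then show ?thesis
        using measurable_space[OF _ v] by simp
    qed
    have g: "\<kappa> < \<gamma> k v"
      unfolding gamma_def using S.stepsize_gt[OF alpha, of "sqrt (real K)" "x k v" "\<xi>' k v"] K
      by (simp add: S.stepsize_def)
    \<comment> \<open>Minimality over the whole space, tested at the previous iterate, gives a
      finite value and so keeps the run in the domain.\<close>
    have "\<phi> (x (Suc k) v) < \<infinity>"
      using min[of "x k v"] by (rule le_less_trans) (simp add: \<phi>_def fin[OF xC])
    then have yC: "x (Suc k) v \<in> C"
      using inf[of "x (Suc k) v"] by (auto simp: \<phi>_def)
    have TC: "S.model_prox (x k v) (\<gamma> k v) (\<xi> k v) \<in> C"
      using S.model_prox_minimizer[OF xC s g] by blast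
    have "x (Suc k) v = S.model_prox (x k v) (\<gamma> k v) (\<xi> k v)"
      using min[of "S.model_prox (x k v) (\<gamma> k v) (\<xi> k v)"]
      by (intro S.model_prox_unique[OF xC s g yC]) (simp add: \<phi>_def fin[OF yC] fin[OF TC])
    with yC show ?thesis
      by simp
  qed
  have x_first: "x 1 v = x1" if "v \<in> space M" for v
    using algorithm that by (simp add: model_based_run_def)
  have x_C: "x k v \<in> C" if "v \<in> space M" "k \<in> {1..Suc K}" for k v
    using that(2)
  proof (induction k)
    case (Suc k)
    then show ?case
      using iterate[OF _ that(1), of k] x_first[OF that(1)] x1C by (cases k) auto
  qed simp
  interpret R: model_run \<Xi> C w f fm Lip \<kappa> \<tau> \<sigma> L\<^sub>\<omega> \<rho> M K \<xi> \<xi>' \<alpha> x1 x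
  proof unfold_locales
    fix k v assume kv: "k \<in> {1..K}" "v \<in> space M"
    then show "x (Suc k) v = S.model_prox (x k v) (S.stepsize \<alpha> (sqrt (real K)) (x k v) (\<xi>' k v)) (\<xi> k v)"
      using iterate[OF kv] x_C[OF kv(2), of k] by (simp add: gamma_def S.stepsize_def)
  qed (use samples K alpha x1C x_first in auto)

  define b where "b = \<rho> / \<alpha>\<^sup>2 * (\<alpha> + \<sigma> + L\<^sub>\<omega>)\<^sup>2"
  have b: "0 < b"
    using S.rho_pos alpha sigma_nonneg S.L_nonneg by (auto simp: b_def intro!: mult_pos_pos divide_pos_pos)
  have budget: "R.budget = b / 2"
    by (simp add: b_def R.budget_def)
  have lower: "- \<Lambda> \<le> S.env y" for y
    using envelope_bounded[of y] by (simp add: env)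
  have Delta: "\<Delta> = S.env x1 + \<Lambda> + b"
    by (simp add: Delta_def env b_def)
  have Delta_pos: "0 < \<Delta>"
    using lower[of x1] b by (simp add: Delta)
  have p0: "0 < p"
    using p delta by simp
  have far: "\<Delta> / \<delta> \<le> S.env y" if "y \<notin> cball 0 R" for y
  proof -
    have "0 \<le> 4 * (\<alpha> + \<sigma> + L\<^sub>\<omega>) / (\<alpha> * sqrt (real K))"
      using alpha sigma_nonneg S.L_nonneg by simp
    then have "B (\<Delta> / \<delta>) \<le> norm y"
      using that by (simp add: R_def)
    then show ?thesis
      using level_sets by (simp add: level_set_bound_def env)
  qed
  have leave: "emeasure M {v \<in> space M. x k v \<notin> cball 0 R} \<le> ennreal \<delta>" if "k \<in> {1..K}" for k
  proof (rule R.prob_leave_ball[OF that lower Lambda_nonneg _ far])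
    show "S.env x1 + \<Lambda> + R.budget \<le> \<delta> * (\<Delta> / \<delta>)"
      using delta b by (simp add: Delta budget)
  qed (use Delta_pos delta in auto)
  let ?m = "(1 - 2 * \<delta> / p) * real K"
  have many: "1 - p \<le> measure M (many_in_ball M x K R ?m)"
    using R.prob_many_in_ball[OF leave delta(1) p0] p0 by simp
  have kth: "1 - p / 2 - \<delta> \<le> measure M (kth_in_ball M x K R ?m k)" if "k \<in> {1..K}" for k
    using R.prob_kth_in_ball[OF leave delta(1) p0 that] .
  have kth': "1 - p \<le> measure M (kth_in_ball M x K R ?m k)" if "k \<in> {1..K}" for k
    using kth[OF that] p by simp

  \<comment> \<open>The reciprocal 2 p / (p - 2 \<delta>), multiplied by \<rho> / (\<rho> - \<tau> -
    \<kappa>), is exactly the product of the two leading factors of the claim.\<close>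
  define c where "c = (p - 2 * \<delta>) / (2 * p)"
  have c: "0 < c"
    using p p0 by (simp add: c_def)
  have "c \<le> 1 - p / 2 - \<delta>"
  proof -
    \<comment> \<open>Divided by \<open>p\<close>, this product is the difference of the two sides
      of the claim.\<close>
    have "0 \<le> (1 - p) * (p / 2 + \<delta>)"
      using p p0 delta by simp
    then show ?thesis
      using p0 by (simp add: c_def field_simps)
  qed
  then have c_le: "c \<le> measure M (kth_in_ball M x K R ?m k)" if "k \<in> {1..K}" for k
    using kth[OF that] by simp

  define m where "m = real_of_ereal (INF y. \<psi> y)"
  \<comment> \<open>The infimum lies between -\<Lambda> and the value at \<open>x1\<close>, so
    \<open>real_of_ereal\<close> returns it and not a default value.\<close>
  have m: "(INF y. \<psi> y) = ereal m"
  proof -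
    have "ereal (- \<Lambda>) \<le> (INF y. \<psi> y)"
      by (rule INF_greatest) (rule psi_lower)
    moreover have "(INF y. \<psi> y) \<le> ereal (f x1 + w x1)"
      unfolding psi_C[OF x1C, symmetric] by (rule INF_lower) simp
    ultimately show ?thesis
      unfolding m_def by (cases "INF y. \<psi> y") auto
  qed
  have m_env: "m \<le> S.env y" for y
  proof -
    have "ereal m \<le> \<psi> (S.prox y)"
      unfolding m[symmetric] by (rule INF_lower) simp
    moreover have "0 \<le> \<rho> / 2 * (norm (S.prox y - y))\<^sup>2"
      using S.rho_pos by simp
    ultimately show ?thesis
      by (simp add: psi_C[OF S.prox_in] S.env_def)
  qed
  have D: "S.env x1 - m \<le> D"
    using env_le_psi[of x1] by (simp add: D_def m env psi_C[OF x1C])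
  define a where "a = p / (p - 2 * \<delta>) * (2 * \<rho> / (\<rho> - \<tau> - \<kappa>)) * (D + b)"
  have gap: "0 < \<rho> - \<tau> - \<kappa>" "0 < \<rho> + \<tau> + \<kappa>"
    using rho S.constants by auto
  have Db: "0 < D + b"
    using D m_env[of x1] b by simp
  have a: "0 < a"
    unfolding a_def using p p0 gap S.rho_pos Db by (intro mult_pos_pos divide_pos_pos) auto
  let ?E = "MIN k\<in>{1..K}. expectation_given M (kth_in_ball M x K R ?m k)
      (\<lambda>v. (norm (gradient S.env (x k v)))\<^sup>2)"
  have "?E \<le> ennreal a * (ennreal ((\<rho> + \<tau> + \<kappa>) / real K) + (ennreal \<alpha> + G) / ennreal (sqrt (real K)))"
  proof (cases G)
    \<comment> \<open>With no finite Lipschitz bound on the ball, the right side is infinite because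
      \<open>a\<close> is positive.\<close>
    case top
    have "(ennreal \<alpha> + G) / ennreal (sqrt (real K)) = top"
      by (simp add: top ennreal_top_divide)
    then show ?thesis
      using a by (simp add: ennreal_mult_top)
  next
    case (real G')
    have Lip: "Lip y s \<le> G'" if "y \<in> C \<inter> cball 0 R" "s \<in> space \<Xi>" for y s
    proof -
      have "ennreal (Lip y s) \<le> G"
        unfolding G_def lip_sup_def using that
        by (intro SUP_upper2[of y] SUP_upper2[of s]) (auto simp: C_def)
      then show ?thesis
        using real by simp
    qed
    have "?E \<le> ennreal (1 / c * (\<rho> / (\<rho> - \<tau> - \<kappa>)) * (S.env x1 - m + R.budget)
        * ((\<rho> + \<tau> + \<kappa>) / real K + (\<alpha> + G') / sqrt (real K)))"
      by (rule R.min_gradient_bound[where r = R])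
        (use m_env c c_le R.sets_kth_in_ball real Lip in \<open>auto simp: kth_in_ball_def\<close>)
    also have "\<dots> \<le> ennreal (a * ((\<rho> + \<tau> + \<kappa>) / real K + (\<alpha> + G') / sqrt (real K)))"
    proof (intro ennreal_leI mult_right_mono)
      have "1 / c * (\<rho> / (\<rho> - \<tau> - \<kappa>)) * (S.env x1 - m + R.budget) \<le> 1 / c * (\<rho> / (\<rho> - \<tau> - \<kappa>)) * (D + b)"
        using c S.rho_pos gap D b by (intro mult_left_mono) (auto simp: budget)
      also have "\<dots> = a"
        by (simp add: a_def c_def)
      finally show "1 / c * (\<rho> / (\<rho> - \<tau> - \<kappa>)) * (S.env x1 - m + R.budget) \<le> a" .
    qed (use gap alpha real in auto)
    also have "\<dots> = ennreal a * (ennreal ((\<rho> + \<tau> + \<kappa>) / real K) + (ennreal \<alpha> + G) / ennreal (sqrt (real K)))"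
      using a gap alpha real K by (simp add: ennreal_mult ennreal_plus[symmetric] divide_ennreal del: ennreal_plus)
    finally show ?thesis .
  qed
  then show ?thesis
    using many kth' by (simp add: env a_def b_def)
qed

end
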